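(* For all integers $n\ge2$ and $k\ge0$, the map $\Phi$ restricts to a bijection between well-labelled Motzkin paths of size $n$ with $k$ horizontal steps and labelled binary trees with $n$ leaves exactly $k$ of which are single, and the map $\Psi$ restricts to a bijection between the latter trees and matchings on $[2n-2]$ having exactly $k$ pairs $\{i,j\}$ with $i\in\{1,\ldots,n\}$ and $j\in\{n+1,\ldots,2n-2\}$.
   Context: A well-labelled path of size $n$: $(\mathbf{p},\sigma)$ with $\mathbf{p}=p_1\ldots p_{n-1}$ a word on $\{-1,0,+1\}$, $\sigma$ a permutation of $[n]$, $p_i=-1\Rightarrow\sigma_i<\sigma_{i+1}$, $p_i=1\Rightarrow\sigma_i>\sigma_{i+1}$; Motzkin if $\sum_{i\le j}p_i\ge0$ for $j\le n-2$ and $\sum_{i\le n-1}p_i=-1$. A horizontal step is a letter $0$ of $\mathbf{p}$. A labelled binary tree of size $n$: rooted tree with $n$ leaves with distinct labels in $[n]$, unlabelled internal vertices each with exactly two unordered children. A leaf is single if its sibling is an internal vertex. A matching on $[2m]$ is a fixed-point-free involution. $\lambda_I$ is the order-preserving bijection $[|I|]\to I$; $\lambda(\tau)$ relabels the leaves of $\tau$ via $\lambda$. $\Phi$ (Motzkin paths of size $n\ge2$ to trees): $n=2$ gives a root with leaves $1,2$; for $n>2$, $p_1=0$: a root with subtrees a leaf $\sigma_1$ and $\lambda_{[n]\setminus\{\sigma_1\}}(\Phi(p_2\ldots p_{n-1},\sigma'))$ where $\sigma'_i=\lambda^{-1}_{[n]\setminus\{\sigma_1\}}(\sigma_{i+1})$;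 for $n>2$, $p_1=1$: with $k$ least such that $\sum_{i\le k}p_i=0$, a root with subtrees $\lambda_{I'}(\Phi(\mathbf{p}',\sigma'))$, $\lambda_{I''}(\Phi(\mathbf{p}'',\sigma''))$, where $I'=\{\sigma_1,\ldots,\sigma_k\}$, $I''=\{\sigma_{k+1},\ldots,\sigma_n\}$, $p'_i=-p_{k-i}$ ($i<k$), $p''_i=p_{k+i}$ ($i<n-k$), $\sigma'_i=\lambda^{-1}_{I'}(\sigma_{k+1-i})$, $\sigma''_i=\lambda^{-1}_{I''}(\sigma_{k+i})$. $\Psi$ (trees of size $n$ to matchings on $[2n-2]$): label the $n-2$ internal non-root vertices: while unlabelled non-root vertices remain, among those whose two children are both labelled pick the one having the child with least label, and give it the least unused label in $[2n-2]\setminus[n]$; then $\Psi(\tau)$ pairs $i$ and $j$ whenever they label siblings. *)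

theory Defs
  imports Main "HOL-Library.While_Combinator"
begin

text \<open>A path of size n is a pair (p, sigma): p is the word p_1 ... p_(n-1) (list index i-1
 holds p_i), sigma is the permutation sigma_1 ... sigma_n of [n] written as a list.\<close>

definition well_labelled_path :: "nat \<Rightarrow> int list \<Rightarrow> nat list \<Rightarrow> bool" where
  "well_labelled_path n p \<sigma> \<longleftrightarrow>
     length p = n - 1 \<and> set p \<subseteq> {-1, 0, 1} \<and>
     length \<sigma> = n \<and> distinct \<sigma> \<and> set \<sigma> = {1..n} \<and>
     (\<forall>i < n - 1. (p ! i = -1 \<longrightarrow> \<sigma> ! i < \<sigma> ! (i+1)) \<and>
                   (p ! i = 1 \<longrightarrow> \<sigma> ! i > \<sigma> ! (i+1)))"

definition motzkin_word :: "nat \<Rightarrow> int list \<Rightarrow> bool" where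
  "motzkin_word n p \<longleftrightarrow>
     (\<forall>j. 1 \<le> j \<and> j \<le> n - 2 \<longrightarrow> sum_list (take j p) \<ge> 0) \<and> sum_list (take (n - 1) p) = -1"

definition well_labelled_motzkin :: "nat \<Rightarrow> int list \<Rightarrow> nat list \<Rightarrow> bool" where
  "well_labelled_motzkin n p \<sigma> \<longleftrightarrow> well_labelled_path n p \<sigma> \<and> motzkin_word n p"

definition horizontal_steps :: "int list \<Rightarrow> nat" where
  "horizontal_steps p = length (filter (\<lambda>x. x = 0) p)"

datatype ltree = Leaf nat | Node ltree ltree

fun leaves :: "ltree \<Rightarrow> nat list" where
  "leaves (Leaf a) = [a]"
| "leaves (Node l r) = leaves l @ leaves r"

fun is_leaf :: "ltree \<Rightarrow> bool" where
  "is_leaf (Leaf _) = True"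
| "is_leaf (Node _ _) = False"

text \<open>Children are unordered: each unordered tree is represented by its unique canonical
 ordered representative, in which the left child carries the smaller minimal leaf label.\<close>

fun canonical :: "ltree \<Rightarrow> bool" where
  "canonical (Leaf _) = True"
| "canonical (Node l r) \<longleftrightarrow> canonical l \<and> canonical r \<and> Min (set (leaves l)) < Min (set (leaves r))"

definition node :: "ltree \<Rightarrow> ltree \<Rightarrow> ltree" where
  "node l r = (if Min (set (leaves l)) < Min (set (leaves r)) then Node l r else Node r l)"

definition labelled_binary_tree :: "nat \<Rightarrow> ltree \<Rightarrow> bool" where
  "labelled_binary_tree n t \<longleftrightarrow> canonical t \<and> length (leaves t) = n \<and> distinct (leaves t)
     \<and> set (leaves t) = {1..n}"

fun single_leaves :: "ltree \<Rightarrow> nat" where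
  "single_leaves (Leaf _) = 0"
| "single_leaves (Node l r) = single_leaves l + single_leaves r + (if is_leaf l \<noteq> is_leaf r then 1 else 0)"

fun relabel :: "(nat \<Rightarrow> nat) \<Rightarrow> ltree \<Rightarrow> ltree" where
  "relabel f (Leaf a) = Leaf (f a)"
| "relabel f (Node l r) = Node (relabel f l) (relabel f r)"

definition lam :: "nat set \<Rightarrow> nat \<Rightarrow> nat" where
  "lam I i = sorted_list_of_set I ! (i - 1)"

definition lam_inv :: "nat set \<Rightarrow> nat \<Rightarrow> nat" where
  "lam_inv I x = the_inv_into {1..card I} (lam I) x"

definition first_return :: "int list \<Rightarrow> nat" where
  "first_return p = (LEAST k. 0 < k \<and> sum_list (take k p) = 0)"

lemma first_return_pos:
  assumes "\<exists>k>0. sum_list (take k p) = 0"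
  shows "0 < first_return p"
  unfolding first_return_def using LeastI_ex[of "\<lambda>k. 0 < k \<and> sum_list (take k p) = 0"] assms
  by blast

lemma first_return_le:
  assumes "\<exists>k>0. sum_list (take k p) = 0" and "p \<noteq> []"
  shows "first_return p \<le> length p"
proof -
  obtain k0 where k0: "0 < k0" "sum_list (take k0 p) = 0" using assms(1) by blast
  have "0 < min k0 (length p) \<and> sum_list (take (min k0 (length p)) p) = 0"
    using k0 assms(2) by (cases "k0 \<le> length p") (auto simp: min_def)
  then have "first_return p \<le> min k0 (length p)"
    unfolding first_return_def by (rule Least_le)
  then show ?thesis by simp
qed

text \<open>The input size is n = length sigma = length p + 1; the base case n = 2 corresponds
 to length p <= 1. The last branch is never reached on Motzkin paths (junk value).\<close>
function phi :: "int list \<Rightarrow> nat list \<Rightarrow> ltree" where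
  "phi p \<sigma> =
    (if length p \<le> 1 then node (Leaf 1) (Leaf 2)
     else if hd p = 0 then
       (let J = {1..length \<sigma>} - {hd \<sigma>};
            \<sigma>' = map (lam_inv J) (tl \<sigma>)
        in node (Leaf (hd \<sigma>)) (relabel (lam J) (phi (tl p) \<sigma>')))
     else if hd p = 1 \<and> (\<exists>k>0. sum_list (take k p) = 0) then
       (let k = first_return p;
            I1 = set (take k \<sigma>); I2 = set (drop k \<sigma>);
            p1 = map uminus (rev (take (k - 1) p)); p2 = drop k p;
            \<sigma>1 = map (lam_inv I1) (rev (take k \<sigma>));
            \<sigma>2 = map (lam_inv I2) (drop k \<sigma>)
        in node (relabel (lam I1) (phi p1 \<sigma>1)) (relabel (lam I2) (phi p2 \<sigma>2)))
     else Leaf 0)"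
  by pat_completeness auto
termination
proof (relation "measure (\<lambda>(p, \<sigma>). length p)", goal_cases)
  case 1 then show ?case by simp
next
  case 2 then show ?case by simp
next
  case (3 p \<sigma> x xa xb xc xd xe xf)
  then have "p \<noteq> []" by auto
  with 3 have "x \<le> length p" "0 < x" using first_return_le[of p] first_return_pos[of p] by auto
  with 3 show ?case by (auto simp: min_def)
next
  case (4 p \<sigma> x xa xb xc xd xe xf)
  then have "0 < x" using first_return_pos[of p] by auto
  with 4 show ?case by auto
qed

text \<open>Vertices of a tree are addressed by positions (paths from the root).\<close>
fun subtree_at :: "ltree \<Rightarrow> bool list \<Rightarrow> ltree option" where
  "subtree_at t [] = Some t"
| "subtree_at (Leaf _) (_ # _) = None"
| "subtree_at (Node l r) (b # q) = subtree_at (if b then r else l) q"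

definition internal_nonroot :: "ltree \<Rightarrow> bool list \<Rightarrow> bool" where
  "internal_nonroot t q \<longleftrightarrow> q \<noteq> [] \<and> (\<exists>l r. subtree_at t q = Some (Node l r))"

definition initial_labels :: "ltree \<Rightarrow> bool list \<Rightarrow> nat option" where
  "initial_labels t q = (case subtree_at t q of Some (Leaf a) \<Rightarrow> Some a | _ \<Rightarrow> None)"

definition psi_step :: "ltree \<Rightarrow> (bool list \<Rightarrow> nat option) \<Rightarrow> (bool list \<Rightarrow> nat option)" where
  "psi_step t lab =
    (let n = length (leaves t);
         C = {q. internal_nonroot t q \<and> lab q = None \<and>
                 lab (q @ [False]) \<noteq> None \<and> lab (q @ [True]) \<noteq> None};
         mc = (\<lambda>q. min (the (lab (q @ [False]))) (the (lab (q @ [True]))));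
         q0 = (THE q. q \<in> C \<and> (\<forall>q'\<in>C. mc q \<le> mc q'));
         l = (LEAST l. l \<in> {1..2*n-2} - {1..n} \<and> l \<notin> ran lab)
     in lab(q0 := Some l))"

definition psi_labels :: "ltree \<Rightarrow> bool list \<Rightarrow> nat option" where
  "psi_labels t = while (\<lambda>lab. \<exists>q. internal_nonroot t q \<and> lab q = None) (psi_step t) (initial_labels t)"

definition psi :: "ltree \<Rightarrow> nat \<Rightarrow> nat" where
  "psi t = (let n = length (leaves t); lab = psi_labels t in
     (\<lambda>i. if i \<in> {1..2*n-2} then (THE j. \<exists>q b. lab (q @ [b]) = Some i \<and> lab (q @ [\<not> b]) = Some j)
          else i))"

text \<open>A matching on [m] is a fixed-point-free involution of [m]; for extensionality it is
 taken to be the identity outside [m].\<close>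
definition matching :: "nat \<Rightarrow> (nat \<Rightarrow> nat) \<Rightarrow> bool" where
  "matching m f \<longleftrightarrow> (\<forall>i\<in>{1..m}. f i \<in> {1..m} \<and> f (f i) = i \<and> f i \<noteq> i) \<and> (\<forall>i. i \<notin> {1..m} \<longrightarrow> f i = i)"

definition crossing_pairs :: "nat \<Rightarrow> (nat \<Rightarrow> nat) \<Rightarrow> nat" where
  "crossing_pairs n f = card {i \<in> {1..n}. f i \<in> {n+1..2*n-2}}"

end

theory Submission
  imports Defs
begin

text \<open>
  \<^bold>\<open>The map \<open>\<Phi>\<close>.\<close> A Motzkin path that starts with an up step factors at its first return to \<open>0\<close> as the
  reflection of a Motzkin path, a down step, and a second Motzkin path. The down step only says that the
  first label of the first factor is smaller than the first label of the second one, so an unordered pair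
  of paths with disjoint labels can be joined in exactly one order. A leading horizontal step
  contributes a single leaf without any condition on the labels.

  \<^bold>\<open>The map \<open>\<Psi>\<close>.\<close> Both a tree and the matching of its sibling labels determine the labels of the internal
  vertices greedily: the next label goes to the available pair with the least element. Hence a matching
  determines the parent label of every label, and from the parent labels the tree is rebuilt from the
  leaves. For an arbitrary matching the greedy choice never gets stuck, because at every stage there are
  two more available labels than labels still to be created.
\<close>

section \<open>Motzkin paths and trees\<close>

text \<open>\<open>phi\<close> standardises labels at every call and \<open>psi_labels\<close> is
  the outcome of a loop, so neither is easy to invert as it stands. Each is replaced by a
  description that can be checked without running it. For \<open>psi\<close> this is the locale
  \<open>greedy_labelling\<close>: its clause \<open>greedy\<close> recovers the choices of the loop
  from the labels alone, because another vertex was available when \<open>v\<close> was assigned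
  exactly if its children have labels below \<open>v\<close> while its own label is missing or above
  \<open>v\<close>. A labelling that satisfies the clauses with all of \<open>{1..2n-2}\<close> used
  is then the result of the loop, so for a tree rebuilt from a matching it suffices to exhibit one.
  The locale \<open>greedy_parents\<close> states the same clause for the pairs of a matching
  instead of the vertices of a tree. The number \<open>k\<close> never enters the constructions:
  each horizontal step creates one single leaf, and the labels up to \<open>n\<close> are those of
  the leaves.\<close>

definition motzkin :: "int list \<Rightarrow> bool" where
  "motzkin p \<longleftrightarrow> p \<noteq> [] \<and> (\<forall>j<length p. 0 \<le> sum_list (take j p)) \<and> sum_list p = -1"

text \<open>The alphabet is part of the condition, so that \<open>compatible\<close> carries it
  along when words are cut and joined.\<close>

definition step_ok :: "int \<Rightarrow> nat \<Rightarrow> nat \<Rightarrow> bool" where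
  "step_ok x a b \<longleftrightarrow> x \<in> {-1, 0, 1} \<and> (x = -1 \<longrightarrow> a < b) \<and> (x = 1 \<longrightarrow> b < a)"

definition compatible :: "int list \<Rightarrow> nat list \<Rightarrow> bool" where
  "compatible p \<sigma> \<longleftrightarrow> length \<sigma> = Suc (length p) \<and> (\<forall>i<length p. step_ok (p ! i) (\<sigma> ! i) (\<sigma> ! Suc i))"

section \<open>Concatenation and reflection of labelled words\<close>

lemma compatible_singleton: "compatible [x] [a, b] \<longleftrightarrow> step_ok x a b"
  by (simp add: compatible_def)

lemma compatible_Cons:
  "compatible (x # p) (a # \<sigma>) \<longleftrightarrow> \<sigma> \<noteq> [] \<and> step_ok x a (hd \<sigma>) \<and> compatible p \<sigma>"
  by (cases \<sigma>) (auto simp: compatible_def All_less_Suc2)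

lemma compatible_append:
  assumes "length \<sigma> = Suc (length p)"
  shows "compatible (p @ x # p') (\<sigma> @ \<sigma>') \<longleftrightarrow>
    \<sigma>' \<noteq> [] \<and> compatible p \<sigma> \<and> step_ok x (last \<sigma>) (hd \<sigma>') \<and> compatible p' \<sigma>'"
  using assms
proof (induction p arbitrary: \<sigma>)
  case Nil
  then obtain a where "\<sigma> = [a]" by (cases \<sigma>) auto
  then show ?case by (auto simp: compatible_Cons) (auto simp: compatible_def)
next
  case (Cons y p)
  then obtain a \<tau> where s: "\<sigma> = a # \<tau>" "length \<tau> = Suc (length p)" by (cases \<sigma>) auto
  then have "\<tau> \<noteq> []" by auto
  with Cons.IH[OF s(2)] s show ?case by (auto simp: compatible_Cons)
qed

lemma step_ok_uminus: "step_ok (- x) a b \<longleftrightarrow> step_ok x b a"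
  by (auto simp: step_ok_def)

text \<open>Reversal exchanges ascents with descents and negation exchanges up steps with down
  steps; the two effects cancel.\<close>

lemma compatible_rev: "compatible (map uminus (rev p)) (rev \<sigma>) \<longleftrightarrow> compatible p \<sigma>"
proof (induction p arbitrary: \<sigma>)
  case Nil
  then show ?case by (simp add: compatible_def)
next
  case (Cons x p)
  show ?case
  proof (cases \<sigma>)
    case Nil
    then show ?thesis by (simp add: compatible_def)
  next
    case (Cons a \<tau>)
    show ?thesis
    proof (cases "length \<tau> = Suc (length p)")
      case True
      then have "\<tau> \<noteq> []" by auto
      with True Cons Cons.IH[of \<tau>] show ?thesis
        by (auto simp: compatible_append compatible_Cons step_ok_uminus last_rev)
          (auto simp: compatible_def)
    next
      case False
      with Cons show ?thesis by (simp add: compatible_def)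
    qed
  qed
qed

lemma sum_list_uminus: "sum_list (map uminus xs) = - sum_list (xs :: int list)"
  by (induction xs) auto

lemma sum_list_take_drop: "sum_list (drop j xs) = sum_list xs - sum_list (take j (xs :: int list))"
  using sum_list_append[of "take j xs" "drop j xs"] by simp

lemma sum_list_take_rev_uminus:
  "sum_list (take j (map uminus (rev xs))) = sum_list (take (length xs - j) xs) - sum_list (xs :: int list)"
  by (simp add: take_map take_rev sum_list_uminus sum_list_take_drop rev_map[symmetric])

text \<open>Since \<open>p1\<close> sums to \<open>-1\<close>, the first \<open>j\<close> letters of
  its reflection sum to one more than a proper prefix of \<open>p1\<close>.\<close>

lemma join_prefix_sums:
  assumes "motzkin p1" and "0 < j" and "j \<le> length p1"
  shows "0 < sum_list (take j (map uminus (rev p1) @ q))"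
proof -
  have "length p1 - j < length p1" using assms by linarith
  then have "0 \<le> sum_list (take (length p1 - j) p1)" "sum_list p1 = -1"
    using assms(1) by (auto simp: motzkin_def)
  then show ?thesis using assms by (simp add: sum_list_take_rev_uminus)
qed

lemma sum_list_join:
  assumes "motzkin p1"
  shows "sum_list (map uminus (rev p1) @ -1 # q) = sum_list q"
  using assms by (simp add: motzkin_def sum_list_uminus)

lemma join_suffix_sums:
  assumes "motzkin p1" and "length p1 < j"
  shows "sum_list (take j (map uminus (rev p1) @ -1 # p2)) = sum_list (take (j - Suc (length p1)) p2)"
proof -
  obtain i where "j = Suc (length p1) + i" using assms(2) less_iff_Suc_add by auto
  with assms(1) show ?thesis by (simp add: motzkin_def sum_list_uminus)
qed

lemma motzkin_join:
  assumes "motzkin p1" and "motzkin p2"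
  shows "motzkin (map uminus (rev p1) @ -1 # p2)" (is "motzkin ?p")
proof -
  have "0 \<le> sum_list (take j ?p)" if "j < length ?p" for j
  proof (cases "j \<le> length p1")
    case True
    then show ?thesis using join_prefix_sums[OF assms(1), of j] by (cases "j = 0") (auto simp: less_imp_le)
  next
    case False
    then have "j - Suc (length p1) < length p2" using that by auto
    then have "0 \<le> sum_list (take (j - Suc (length p1)) p2)" using assms(2) by (simp add: motzkin_def)
    with False show ?thesis using join_suffix_sums[OF assms(1), of j p2] by linarith
  qed
  with assms show ?thesis by (simp add: motzkin_def sum_list_join[OF assms(1)] del: sum_list_append)
qed

text \<open>The reflected factor stays positive and ends at height \<open>1\<close>, so the inserted
  down step is the first return. Hence \<open>phi\<close> cuts a joined word exactly where it was
  glued.\<close>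

lemma first_return_join:
  assumes "motzkin p1"
  shows "first_return (map uminus (rev p1) @ -1 # p2) = Suc (length p1)" (is "first_return ?p = _")
  unfolding first_return_def
proof (rule Least_equality)
  show "0 < Suc (length p1) \<and> sum_list (take (Suc (length p1)) ?p) = 0"
    using join_suffix_sums[OF assms, of "Suc (length p1)"] by simp
next
  fix k assume "0 < k \<and> sum_list (take k ?p) = 0"
  then show "Suc (length p1) \<le> k" using join_prefix_sums[OF assms, of k "-1 # p2"] by (auto simp: not_less_eq_eq[symmetric] simp del: sum_list_append take_append)
qed

lemma hd_join:
  assumes "motzkin p1" and "set p1 \<subseteq> {-1, 0, 1}"
  shows "hd (map uminus (rev p1) @ q) = 1"
proof -
  have ne: "p1 \<noteq> []" using assms by (simp add: motzkin_def)
  then have "0 < last (map uminus p1) \<or> 0 < hd (map uminus (rev p1) @ q)"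
    using join_prefix_sums[OF assms(1), of 1 q] by (cases "rev p1") auto
  with ne have "last p1 < 0" by (auto simp: last_map hd_map hd_rev)
  moreover have "last p1 \<in> {-1, 0, 1}" using ne assms(2) last_in_set by blast
  ultimately show ?thesis using ne by (auto simp: hd_append hd_map hd_rev)
qed

text \<open>The graph of \<open>\<Phi>\<close> for arbitrary sets of labels, which makes the standardisations \<open>\<lambda>\<^sub>I\<close> disappear
  from the recursion.\<close>

inductive path_tree :: "int list \<Rightarrow> nat list \<Rightarrow> ltree \<Rightarrow> bool" where
  base: "a < b \<Longrightarrow> path_tree [-1] [a, b] (Node (Leaf a) (Leaf b))"
| flat: "path_tree p \<sigma> t \<Longrightarrow> a \<notin> set \<sigma> \<Longrightarrow> path_tree (0 # p) (a # \<sigma>) (node (Leaf a) t)"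
| join: "path_tree p1 \<sigma>1 t1 \<Longrightarrow> path_tree p2 \<sigma>2 t2 \<Longrightarrow> set \<sigma>1 \<inter> set \<sigma>2 = {} \<Longrightarrow> hd \<sigma>1 < hd \<sigma>2
    \<Longrightarrow> path_tree (map uminus (rev p1) @ -1 # p2) (rev \<sigma>1 @ \<sigma>2) (node t1 t2)"

section \<open>Trees with unordered children and the relation \<open>path_tree\<close>\<close>

declare Min_less_iff [simp del] Min_gr_iff [simp del]

lemma leaves_ne [simp]: "leaves t \<noteq> []"
  by (induction t) auto

lemma set_leaves_node [simp]: "set (leaves (node l r)) = set (leaves l) \<union> set (leaves r)"
  by (auto simp: node_def)

lemma not_is_leaf_node [simp]: "\<not> is_leaf (node l r)"
  by (simp add: node_def)

lemma single_leaves_node: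
  "single_leaves (node l r) = single_leaves l + single_leaves r + (if is_leaf l \<noteq> is_leaf r then 1 else 0)"
  by (auto simp: node_def)

lemma Min_leaves_neq:
  assumes "set (leaves l) \<inter> set (leaves r) = {}"
  shows "Min (set (leaves l)) \<noteq> Min (set (leaves r))"
  using assms Min_in[of "set (leaves l)"] Min_in[of "set (leaves r)"] by (metis disjoint_iff finite_set leaves_ne set_empty)

lemma canonical_node:
  assumes "canonical l" and "canonical r" and "set (leaves l) \<inter> set (leaves r) = {}"
  shows "canonical (node l r)"
  using assms Min_leaves_neq[OF assms(3)] by (auto simp: node_def)

text \<open>On equal minima \<open>node\<close> puts its second argument first, so symmetry depends
  on the minima being different.\<close>

lemma node_commute:
  assumes "set (leaves l) \<inter> set (leaves r) = {}"
  shows "node r l = node l r"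
  using Min_leaves_neq[OF assms] by (auto simp: node_def)

lemma node_eq_Node: "canonical (Node l r) \<Longrightarrow> node l r = Node l r"
  by (simp add: node_def)

text \<open>In the join case the down step links the last entry of \<open>rev \<sigma>1\<close>,
  which is \<open>hd \<sigma>1\<close>, to \<open>hd \<sigma>2\<close>; the last premise of the rule
  is precisely its label condition.\<close>

lemma path_tree_path:
  assumes "path_tree p \<sigma> t"
  shows "motzkin p \<and> compatible p \<sigma> \<and> distinct \<sigma>"
  using assms
proof induction
  case (base a b)
  then show ?case by (simp add: motzkin_def compatible_singleton step_ok_def)
next
  case (flat p \<sigma> t a)
  have "0 \<le> sum_list (take j (0 # p))" if "j < length (0 # p)" for j
    using flat.IH that by (cases j) (auto simp: motzkin_def)
  with flat show ?case
    by (auto simp: compatible_Cons step_ok_def) (auto simp: motzkin_def compatible_def)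
next
  case (join p1 \<sigma>1 t1 p2 \<sigma>2 t2)
  have len: "length \<sigma>1 = Suc (length p1)" "length \<sigma>2 = Suc (length p2)"
    using join.IH by (auto simp: compatible_def)
  then have ne: "\<sigma>1 \<noteq> []" "\<sigma>2 \<noteq> []" by auto
  have "compatible (map uminus (rev p1) @ -1 # p2) (rev \<sigma>1 @ \<sigma>2)"
    using join ne len by (subst compatible_append) (auto simp: compatible_rev last_rev step_ok_def)
  with join show ?case by (auto simp: motzkin_join)
qed

lemma compatible_set: "compatible p \<sigma> \<Longrightarrow> set p \<subseteq> {-1, 0, 1}"
  by (force simp: compatible_def step_ok_def in_set_conv_nth)

lemma horizontal_steps_simps:
  "horizontal_steps [] = 0"
  "horizontal_steps (x # p) = (if x = 0 then 1 else 0) + horizontal_steps p"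
  "horizontal_steps (p @ q) = horizontal_steps p + horizontal_steps q"
  "horizontal_steps (rev p) = horizontal_steps p"
  "horizontal_steps (map uminus p) = horizontal_steps p"
  by (auto simp: horizontal_steps_def rev_filter[symmetric] filter_map o_def)

text \<open>The clause \<open>\<not> is_leaf t\<close> drives the count: a flat step attaches a leaf
  to an internal vertex and so creates one single leaf, while \<open>base\<close> and
  \<open>join\<close> create none.\<close>

lemma path_tree_tree:
  assumes "path_tree p \<sigma> t"
  shows "canonical t \<and> distinct (leaves t) \<and> set (leaves t) = set \<sigma> \<and> \<not> is_leaf t
    \<and> single_leaves t = horizontal_steps p"
  using assms
  by induction (auto simp: canonical_node single_leaves_node horizontal_steps_simps, auto simp: node_def)

text \<open>The number of leaves among the children of the root selects the rule. For two internal
  children the first labels of the two paths differ, and their order decides which path is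
  reflected; \<open>node_commute\<close> absorbs that choice.\<close>

lemma path_tree_of_tree:
  assumes "canonical t" and "distinct (leaves t)" and "\<not> is_leaf t"
  shows "\<exists>p \<sigma>. path_tree p \<sigma> t"
  using assms
proof (induction t)
  case (Node l r)
  have dj: "set (leaves l) \<inter> set (leaves r) = {}" using Node.prems by auto
  have t: "node l r = Node l r" "node r l = Node l r"
    using Node.prems node_eq_Node node_commute[OF dj] by auto
  show ?case
  proof (cases l)
    case l: (Leaf a)
    show ?thesis
    proof (cases r)
      case (Leaf b)
      with l Node.prems show ?thesis using path_tree.base[of a b] by auto
    next
      case (Node r1 r2)
      then obtain p \<sigma> where "path_tree p \<sigma> r" using Node.prems Node.IH(2) by auto
      moreover from path_tree_tree[OF this] have "a \<notin> set \<sigma>" using dj l by auto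
      ultimately show ?thesis using path_tree.flat[of p \<sigma> r a] t l by auto
    qed
  next
    case l: (Node l1 l2)
    then obtain p \<sigma> where ps: "path_tree p \<sigma> l" using Node.prems Node.IH(1) by auto
    show ?thesis
    proof (cases r)
      case (Leaf b)
      moreover from path_tree_tree[OF ps] have "b \<notin> set \<sigma>" using dj Leaf by auto
      ultimately show ?thesis using path_tree.flat[OF ps, of b] t by auto
    next
      case (Node r1 r2)
      then obtain p' \<sigma>' where ps': "path_tree p' \<sigma>' r" using Node.prems Node.IH(2) by auto
      have d: "set \<sigma> \<inter> set \<sigma>' = {}" using dj path_tree_tree[OF ps] path_tree_tree[OF ps'] by auto
      have "\<sigma> \<noteq> []" "\<sigma>' \<noteq> []" using path_tree_path[OF ps] path_tree_path[OF ps'] by (auto simp: compatible_def)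
      then have "hd \<sigma> \<noteq> hd \<sigma>'" using d hd_in_set by fastforce
      then have "hd \<sigma> < hd \<sigma>' \<or> hd \<sigma>' < hd \<sigma>" by auto
      then show ?thesis
        using path_tree.join[OF ps ps' d] path_tree.join[OF ps' ps] d t by (auto simp: Int_commute)
    qed
  qed
qed simp

lemma node_eq_node_iff:
  "node a b = node c d \<Longrightarrow> a = c \<and> b = d \<or> a = d \<and> b = c"
  by (auto simp: node_def split: if_splits)

text \<open>\<open>node\<close> determines its arguments up to exchange. Whether they are leaves
  identifies the rule, and in the join case the exchanged order would require both
  \<open>hd \<sigma>1 < hd \<sigma>2\<close> and its converse.\<close>

lemma path_tree_unique:
  assumes "path_tree p \<sigma> t" and "path_tree p' \<sigma>' t"
  shows "p' = p \<and> \<sigma>' = \<sigma>"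
  using assms
proof (induction arbitrary: p' \<sigma>')
  case (base a b)
  from base.prems show ?case
  proof cases
    case (flat p \<sigma> t c)
    then show ?thesis using path_tree_tree[of p \<sigma> t] by (auto simp: node_def split: if_splits)
  next
    case (join p1 \<sigma>1 t1 p2 \<sigma>2 t2)
    then show ?thesis using path_tree_tree[of p1 \<sigma>1 t1] path_tree_tree[of p2 \<sigma>2 t2]
      by (auto simp: node_def split: if_splits)
  qed auto
next
  case (flat p \<sigma> t a)
  have nl: "\<not> is_leaf t" using path_tree_tree flat by blast
  from flat.prems show ?case
  proof cases
    case (base c d)
    with nl show ?thesis by (auto simp: node_def split: if_splits)
  next
    case *: (flat p2 \<sigma>2 t2 c)
    from node_eq_node_iff[OF *(3)] have "c = a" "t2 = t" using nl by auto
    with * flat.IH show ?thesis by auto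
  next
    case (join p1 \<sigma>1 t1 p2 \<sigma>2 t2)
    then show ?thesis using path_tree_tree[of p1 \<sigma>1 t1] path_tree_tree[of p2 \<sigma>2 t2]
      using node_eq_node_iff by fastforce
  qed
next
  case (join p1 \<sigma>1 t1 p2 \<sigma>2 t2)
  have nl: "\<not> is_leaf t1" "\<not> is_leaf t2" using path_tree_tree join.hyps by blast+
  from join.prems show ?case
  proof cases
    case (base c d)
    with nl show ?thesis by (auto simp: node_def split: if_splits)
  next
    case *: (flat p2 \<sigma>2 t2 c)
    from node_eq_node_iff[OF *(3)] nl show ?thesis by auto
  next
    case *: (join p3 \<sigma>3 t3 p4 \<sigma>4 t4)
    from node_eq_node_iff[OF *(3)] show ?thesis
    proof
      assume "t1 = t3 \<and> t2 = t4"
      then show ?thesis using * join.IH by auto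
    next
      assume "t1 = t4 \<and> t2 = t3"
      then have "\<sigma>4 = \<sigma>1" "\<sigma>3 = \<sigma>2" using * join.IH by auto
      then show ?thesis using * join.hyps by auto
    qed
  qed
qed

text \<open>Converse of \<open>motzkin_join\<close>: the word is cut at its first return to
  \<open>0\<close>, and the part before the returning step is reflected back.\<close>

lemma first_return_decomposition:
  assumes "motzkin (1 # p)" and "set p \<subseteq> {-1, 0, 1}"
  shows "\<exists>p1 p2. 1 # p = map uminus (rev p1) @ -1 # p2 \<and> motzkin p1 \<and> motzkin p2"
proof -
  define q where "q = 1 # p"
  define s where "s j = sum_list (take j q)" for j
  \<comment> \<open>The total \<open>-1\<close> guarantees that a height at most \<open>0\<close>
    occurs. As no step falls by more than one, the first such height is \<open>0\<close> and is
    reached by a down step at index \<open>k\<close>.\<close>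
  define k where "k = (LEAST k. s (Suc k) \<le> 0)"
  have q: "set q \<subseteq> {-1, 0, 1}" using assms(2) by (auto simp: q_def)
  have step: "s (Suc j) = s j + q ! j" if "j < length q" for j
    using that by (simp add: s_def take_Suc_conv_app_nth)
  have end_: "s (length q) = -1" using assms(1) by (simp add: s_def motzkin_def q_def)
  have ge0: "0 \<le> s j" if "j < length q" for j using assms(1) that by (simp add: s_def motzkin_def q_def)
  have s1: "s (Suc 0) = 1" by (simp add: s_def q_def)
  have ex: "s (Suc (length p)) \<le> 0" using end_ by (simp add: q_def)
  have k0: "s (Suc k) \<le> 0" unfolding k_def using ex by (rule LeastI)
  have kp: "0 < s (Suc j)" if "j < k" for j
    using not_less_Least[of j "\<lambda>k. s (Suc k) \<le> 0"] that unfolding k_def by linarith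
  have kle: "k \<le> length p" unfolding k_def using ex by (rule Least_le)
  have kpos: "0 < k" using s1 k0 by (cases k) auto
  have sk: "0 < s k" using kp[of "k - 1"] kpos by simp
  have klt: "k < length q" using kle by (simp add: q_def)
  have qk: "q ! k \<in> {-1, 0, 1}" using q klt nth_mem by blast
  have qk1: "q ! k = -1" using step[OF klt] k0 sk qk by auto
  have sk1: "s k = 1" "s (Suc k) = 0" using step[OF klt] k0 sk qk1 by auto
  \<comment> \<open>The height is \<open>0\<close> after the returning step but \<open>-1\<close> at
    the end, so the second factor is nonempty.\<close>
  have k2: "Suc k < length q" using sk1 end_ klt by (metis Suc_lessI zero_neq_neg_one)
  define p1 where "p1 = map uminus (rev (take k q))"
  define p2 where "p2 = drop (Suc k) q"
  have l1: "length p1 = k" using klt by (simp add: p1_def)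
  have dec: "q = map uminus (rev p1) @ -1 # p2"
    using id_take_nth_drop[OF klt] qk1 by (simp add: p1_def p2_def rev_map o_def)
  have "motzkin p1" unfolding motzkin_def
  proof (intro conjI allI impI)
    show "p1 \<noteq> []" using l1 kpos by auto
    show "sum_list p1 = -1" using sk1 by (simp add: p1_def sum_list_uminus s_def)
    fix j assume "j < length p1"
    then have j: "j < k" using l1 by simp
    have "sum_list (take j p1) = s (k - j) - 1"
      using klt sk1 by (simp add: p1_def sum_list_take_rev_uminus s_def min_def)
    moreover have "0 < s (k - j)" using kp[of "k - j - 1"] j by (simp add: Suc_diff_Suc)
    ultimately show "0 \<le> sum_list (take j p1)" by simp
  qed
  moreover have "motzkin p2" unfolding motzkin_def
  proof (intro conjI allI impI)
    show "p2 \<noteq> []" using k2 by (simp add: p2_def)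
    have [simp]: "sum_list (take j p2) = s (Suc k + j)" for j
      using sk1 take_add[of "Suc k" j q] by (simp add: p2_def s_def)
    show "sum_list p2 = -1" using end_ sk1 by (simp add: p2_def s_def sum_list_take_drop)
    fix j assume "j < length p2"
    then have "Suc k + j < length q" by (simp add: p2_def)
    then show "0 \<le> sum_list (take j p2)" using ge0[of "Suc k + j"] by simp
  qed
  ultimately show ?thesis using dec unfolding q_def by blast
qed

text \<open>The first letter decides the rule; for an up step the factors at the first return
  inherit all three hypotheses, so the induction is on length.\<close>

lemma path_tree_of_path:
  assumes "motzkin p" and "compatible p \<sigma>" and "distinct \<sigma>"
  shows "\<exists>t. path_tree p \<sigma> t"
  using assms
proof (induction "length p" arbitrary: p \<sigma> rule: less_induct)
  case less
  have sp: "set p \<subseteq> {-1, 0, 1}" using compatible_set less.prems(2) by blast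
  obtain x q where p: "p = x # q" using less.prems(1) by (cases p) (auto simp: motzkin_def)
  obtain a \<tau> where s: "\<sigma> = a # \<tau>" using less.prems(2) by (cases \<sigma>) (auto simp: compatible_def)
  have c: "step_ok x a (hd \<tau>)" "compatible q \<tau>" using less.prems(2) p s by (auto simp: compatible_Cons)
  show ?case
  proof (cases q)
    case Nil
    then obtain b where "\<tau> = [b]" using c(2) by (cases \<tau>) (auto simp: compatible_def)
    moreover have "x = -1" using less.prems(1) p Nil by (simp add: motzkin_def)
    ultimately show ?thesis using c p s Nil path_tree.base[of a b] by (auto simp: step_ok_def)
  next
    case (Cons y r)
    \<comment> \<open>With a second letter present, the prefix of length one is proper, which
      excludes an initial down step.\<close>
    then have "0 \<le> sum_list (take 1 p)" using less.prems(1) p unfolding motzkin_def by auto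
    then have "x = 0 \<or> x = 1" using sp p by auto
    then show ?thesis
    proof
      assume x: "x = 0"
      have "motzkin q" unfolding motzkin_def
      proof (intro conjI allI impI)
        fix j assume "j < length q"
        then have "0 \<le> sum_list (take (Suc j) p)" using less.prems(1) p unfolding motzkin_def by auto
        then show "0 \<le> sum_list (take j q)" using p x by simp
      qed (use less.prems(1) p x Cons in \<open>auto simp: motzkin_def\<close>)
      then obtain t where "path_tree q \<tau> t" using less.hyps[of q \<tau>] p c less.prems(3) s by auto
      then show ?thesis using path_tree.flat[of q \<tau> t a] p s x less.prems(3) by auto
    next
      assume x: "x = 1"
      then obtain p1 p2 where d: "p = map uminus (rev p1) @ -1 # p2" "motzkin p1" "motzkin p2"
        using first_return_decomposition[of q] less.prems(1) p sp by auto
      define \<sigma>1 where "\<sigma>1 = rev (take (Suc (length p1)) \<sigma>)"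
      define \<sigma>2 where "\<sigma>2 = drop (Suc (length p1)) \<sigma>"
      have s12: "\<sigma> = rev \<sigma>1 @ \<sigma>2" by (simp add: \<sigma>1_def \<sigma>2_def)
      have l1: "length (rev \<sigma>1) = Suc (length (map uminus (rev p1)))"
        using less.prems(2) d(1) by (simp add: \<sigma>1_def compatible_def)
      from less.prems(2)[unfolded d(1) s12] compatible_append[OF l1]
      have cc: "compatible p1 \<sigma>1" "step_ok (-1) (hd \<sigma>1) (hd \<sigma>2)" "compatible p2 \<sigma>2"
        using l1 by (auto simp: compatible_rev last_rev)
      have dd: "distinct \<sigma>1" "distinct \<sigma>2" "set \<sigma>1 \<inter> set \<sigma>2 = {}" using less.prems(3) s12 by auto
      obtain t1 where t1: "path_tree p1 \<sigma>1 t1" using less.hyps[of p1 \<sigma>1] d cc dd by auto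
      obtain t2 where t2: "path_tree p2 \<sigma>2 t2" using less.hyps[of p2 \<sigma>2] d cc dd by auto
      show ?thesis using path_tree.join[OF t1 t2 dd(3)] cc(2) s12 d(1) by (auto simp: step_ok_def)
    qed
  qed
qed

section \<open>Standardisation of labels and the recursion of \<open>phi\<close>\<close>

lemma lam_strict_mono:
  assumes "finite I"
  shows "strict_mono_on {1..card I} (lam I)"
proof (rule strict_mono_onI)
  fix i j assume "i \<in> {1..card I}" "j \<in> {1..card I}" "i < j"
  then show "lam I i < lam I j"
    using assms sorted_wrt_nth_less[OF strict_sorted_list_of_set[of I], of "i - 1" "j - 1"]
    by (auto simp: lam_def)
qed

lemma lam_bij_betw:
  assumes "finite I"
  shows "bij_betw (lam I) {1..card I} I"
proof -
  have "lam I ` {1..card I} = I"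
  proof -
    have "lam I ` {1..card I} = (!) (sorted_list_of_set I) ` {..<card I}"
      unfolding lam_def by (force simp: image_iff Bex_def intro: exI[of _ "Suc _"])
    then show ?thesis using assms nth_image[of "card I" "sorted_list_of_set I"]
      by (simp add: atLeast0LessThan[symmetric])
  qed
  then show ?thesis using lam_strict_mono[OF assms]
    by (auto simp: bij_betw_def strict_mono_on_imp_inj_on)
qed

lemma lam_lam_inv: "finite I \<Longrightarrow> x \<in> I \<Longrightarrow> lam I (lam_inv I x) = x"
  using lam_bij_betw[of I] unfolding lam_inv_def bij_betw_def by (metis f_the_inv_into_f)

lemma lam_inv_image: "finite I \<Longrightarrow> lam_inv I ` I = {1..card I}"
  using bij_betw_imp_surj_on[OF bij_betw_the_inv_into[OF lam_bij_betw[of I]]]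
  by (simp add: lam_inv_def[abs_def])

lemma lam_inv_strict_mono:
  assumes "finite I"
  shows "strict_mono_on I (lam_inv I)"
proof (rule strict_mono_onI)
  fix x y assume xy: "x \<in> I" "y \<in> I" "x < y"
  then have m: "lam_inv I x \<in> {1..card I}" "lam_inv I y \<in> {1..card I}"
    using lam_inv_image[OF assms] by blast+
  show "lam_inv I x < lam_inv I y"
  proof (rule ccontr)
    assume "\<not> ?thesis"
    then have "lam I (lam_inv I y) \<le> lam I (lam_inv I x)"
      using strict_mono_on_imp_mono_on[OF lam_strict_mono[OF assms]] m by (auto simp: mono_on_def)
    then show False using xy assms by (simp add: lam_lam_inv)
  qed
qed

lemma leaves_relabel [simp]: "leaves (relabel f t) = map f (leaves t)"
  by (induction t) auto

text \<open>\<open>node\<close> only compares minima, and a strictly increasing map commutes with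
  taking minima.\<close>

lemma relabel_node:
  assumes "strict_mono_on (set (leaves l) \<union> set (leaves r)) f"
  shows "relabel f (node l r) = node (relabel f l) (relabel f r)"
proof -
  let ?A = "set (leaves l)" and ?B = "set (leaves r)"
  have Min_f: "Min (f ` S) = f (Min S)" if S: "finite S" "S \<noteq> {}" "S \<subseteq> ?A \<union> ?B" for S
  proof (rule Min_eqI)
    fix y assume "y \<in> f ` S"
    then obtain x where x: "x \<in> S" "y = f x" by blast
    have "Min S \<in> ?A \<union> ?B" "x \<in> ?A \<union> ?B" "Min S \<le> x"
      using S(3) x Min_in[OF S(1,2)] Min_le[OF S(1)] by blast+
    then show "f (Min S) \<le> y"
      using mono_onD[OF strict_mono_on_imp_mono_on[OF assms]] x(2) by blast
  qed (use S in auto)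
  have "Min ?A \<in> ?A \<union> ?B" "Min ?B \<in> ?A \<union> ?B" using Min_in[of ?A] Min_in[of ?B] by auto
  then have "f (Min ?A) < f (Min ?B) \<longleftrightarrow> Min ?A < Min ?B"
    using strict_mono_on_less[OF assms] by blast
  then show ?thesis using Min_f[of ?A] Min_f[of ?B] by (simp add: node_def)
qed

lemma relabel_lam_lam_inv:
  assumes "finite I" and "set (leaves t) \<subseteq> I"
  shows "relabel (lam I) (relabel (lam_inv I) t) = t"
  using assms by (induction t) (auto simp: lam_lam_inv)

text \<open>The rules test labels only for order and equality, which a strictly increasing map on
  the labels in use preserves.\<close>

lemma path_tree_relabel:
  assumes "path_tree p \<sigma> t" and "strict_mono_on (set \<sigma>) f"
  shows "path_tree p (map f \<sigma>) (relabel f t)"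
  using assms
proof induction
  case (base a b)
  then show ?case using path_tree.base[of "f a" "f b"] by (auto simp: strict_mono_on_def)
next
  case (flat p \<sigma> t a)
  have m: "strict_mono_on (set \<sigma>) f" using flat.prems by (auto simp: strict_mono_on_def)
  have "f a \<notin> f ` set \<sigma>"
    using strict_mono_on_imp_inj_on[OF flat.prems] flat.hyps by (auto simp: inj_on_def)
  then show ?case using path_tree.flat[OF flat.IH[OF m], of "f a"] flat.prems path_tree_tree[OF flat.hyps(1)]
    by (simp add: relabel_node)
next
  case (join p1 \<sigma>1 t1 p2 \<sigma>2 t2)
  have m: "strict_mono_on (set \<sigma>1) f" "strict_mono_on (set \<sigma>2) f"
    using join.prems by (auto simp: strict_mono_on_def)
  have dj: "set (map f \<sigma>1) \<inter> set (map f \<sigma>2) = {}"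
    using strict_mono_on_imp_inj_on[OF join.prems] join.hyps by (auto simp: inj_on_def)
  have ne: "\<sigma>1 \<noteq> []" "\<sigma>2 \<noteq> []"
    using path_tree_path[OF join.hyps(1)] path_tree_path[OF join.hyps(2)] by (auto simp: compatible_def)
  then have "f (hd \<sigma>1) < f (hd \<sigma>2)"
    using join.prems join.hyps by (auto simp: strict_mono_on_def)
  then show ?case
    using path_tree.join[OF join.IH(1)[OF m(1)] join.IH(2)[OF m(2)] dj] ne join.prems
      path_tree_tree[OF join.hyps(1)] path_tree_tree[OF join.hyps(2)]
    by (simp add: relabel_node hd_map rev_map)
qed

declare phi.simps [simp del]

text \<open>Induction on the length rather than on the derivation, because \<open>phi\<close>
  recurses on standardised labels and the hypothesis is needed for those instead of the labels of
  the subderivation.\<close>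

lemma phi_path_tree:
  assumes "path_tree p \<sigma> t" and "set \<sigma> = {1..length \<sigma>}"
  shows "phi p \<sigma> = t"
  using assms
proof (induction "length p" arbitrary: p \<sigma> t rule: less_induct)
  case less
  \<comment> \<open>A recursive call undoes its own standardisation: the derivation is moved to
    standardised labels, the induction hypothesis evaluates \<open>phi\<close> there, and
    \<open>lam I\<close> moves the result back.\<close>
  have sub: "relabel (lam I) (phi q (map (lam_inv I) \<tau>)) = s"
    if "path_tree q \<tau> s" "length q < length p" "I = set \<tau>" for q \<tau> s I
  proof -
    have I: "finite I" using that by simp
    have d: "distinct \<tau>" using path_tree_path[OF that(1)] by simp
    then have ci: "card I = length \<tau>" using that by (simp add: distinct_card)
    have "path_tree q (map (lam_inv I) \<tau>) (relabel (lam_inv I) s)"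
      using path_tree_relabel[OF that(1)] lam_inv_strict_mono[OF I] that(3) by simp
    then have "phi q (map (lam_inv I) \<tau>) = relabel (lam_inv I) s"
      using less.hyps that lam_inv_image[OF I] ci by simp
    then show ?thesis using relabel_lam_lam_inv[OF I] path_tree_tree[OF that(1)] that(3) by simp
  qed
  from less.prems(1) show ?case
  proof cases
    case (base a b)
    then have "{a, b} = {1, 2}" using less.prems(2) by (auto simp: numeral_2_eq_2 atLeastAtMostSuc_conv)
    with base have "a = 1" "b = 2" by (auto simp: doubleton_eq_iff)
    with base show ?thesis by (subst phi.simps) (simp add: node_def)
  next
    case (flat q \<tau> s a)
    have "q \<noteq> []" using path_tree_path[OF flat(4)] by (simp add: motzkin_def)
    moreover have "{1..length \<sigma>} - {hd \<sigma>} = set \<tau>" using less.prems(2) flat by auto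
    ultimately show ?thesis using flat sub[OF flat(4)]
      by (subst phi.simps) (simp add: Let_def Suc_le_eq)
  next
    case (join p1 \<sigma>1 t1 p2 \<sigma>2 t2)
    have 1: "motzkin p1" "compatible p1 \<sigma>1" using path_tree_path[OF join(4)] by auto
    have 2: "motzkin p2" using path_tree_path[OF join(5)] by auto
    have len: "length \<sigma>1 = Suc (length p1)" using 1 by (simp add: compatible_def)
    have fr: "first_return p = Suc (length p1)" using first_return_join[OF 1(1)] join(1) by simp
    have h: "hd p = 1" using hd_join[OF 1(1) compatible_set[OF 1(2)]] join(1) by simp
    have ex: "\<exists>k>0. sum_list (take k p) = 0"
      using join_suffix_sums[OF 1(1), of "Suc (length p1)" p2] join(1) by (intro exI[of _ "Suc (length p1)"]) simp
    have ne: "p1 \<noteq> []" "p2 \<noteq> []" using 1 2 by (auto simp: motzkin_def)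
    have p1: "map uminus (rev (take (first_return p - 1) p)) = p1"
      using fr join(1) by (simp add: rev_map o_def)
    have p2: "drop (first_return p) p = p2" using fr join(1) by simp
    have s1: "rev (take (first_return p) \<sigma>) = \<sigma>1" "set (take (first_return p) \<sigma>) = set \<sigma>1"
      using fr join(2) len by auto
    have s2: "drop (first_return p) \<sigma> = \<sigma>2" using fr join(2) len by simp
    have len_p: "\<not> length p \<le> 1" using join(1) ne by (cases p1) auto
    have "phi p \<sigma> = node (relabel (lam (set \<sigma>1)) (phi p1 (map (lam_inv (set \<sigma>1)) \<sigma>1)))
        (relabel (lam (set \<sigma>2)) (phi p2 (map (lam_inv (set \<sigma>2)) \<sigma>2)))"
      using len_p h ex unfolding phi.simps[of p \<sigma>] Let_def p1 p2 s1 s2 by simp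
    then show ?thesis using sub[OF join(4)] sub[OF join(5)] join by simp
  qed
qed

text \<open>\<open>n - 2\<close> is the length of the longest proper prefix; the empty prefix, which
  \<open>motzkin_word\<close> omits, has sum \<open>0\<close>.\<close>

lemma motzkin_word_iff:
  assumes "length p = n - 1" and "2 \<le> n"
  shows "motzkin_word n p \<longleftrightarrow> motzkin p"
proof -
  have "(\<forall>j. 1 \<le> j \<and> j \<le> n - 2 \<longrightarrow> 0 \<le> sum_list (take j p)) \<longleftrightarrow> (\<forall>j<length p. 0 \<le> sum_list (take j p))"
  proof (intro iffI allI impI)
    fix j assume "\<forall>j. 1 \<le> j \<and> j \<le> n - 2 \<longrightarrow> 0 \<le> sum_list (take j p)" "j < length p"
    then show "0 \<le> sum_list (take j p)" using assms by (cases "j = 0") auto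
  qed (use assms in auto)
  then show ?thesis using assms by (auto simp: motzkin_word_def motzkin_def)
qed

lemma well_labelled_motzkin_iff:
  assumes "2 \<le> n"
  shows "well_labelled_motzkin n p \<sigma> \<longleftrightarrow>
    motzkin p \<and> compatible p \<sigma> \<and> distinct \<sigma> \<and> length \<sigma> = n \<and> set \<sigma> = {1..n}" (is "?L \<longleftrightarrow> ?R")
proof
  assume ?L
  then have wl: "well_labelled_path n p \<sigma>" and "motzkin_word n p" by (auto simp: well_labelled_motzkin_def)
  moreover have "length p = n - 1" using wl by (simp add: well_labelled_path_def)
  ultimately have "motzkin p" using motzkin_word_iff assms by simp
  moreover have "p ! i \<in> {-1, 0, 1}" if "i < length p" for i
    using wl that nth_mem unfolding well_labelled_path_def by blast
  then have "compatible p \<sigma>" unfolding compatible_def step_ok_def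
    using wl assms unfolding well_labelled_path_def by simp
  ultimately show ?R using wl by (simp add: well_labelled_path_def)
next
  assume R: ?R
  then have "length p = n - 1" by (auto simp: compatible_def)
  moreover have "set p \<subseteq> {-1, 0, 1}" using R compatible_set by blast
  ultimately show ?L using R motzkin_word_iff[OF _ assms, of p]
    by (auto simp: well_labelled_motzkin_def well_labelled_path_def compatible_def step_ok_def)
qed

lemma phi_bij_betw:
  assumes "2 \<le> n"
  shows "bij_betw (\<lambda>(p, \<sigma>). phi p \<sigma>)
    {(p, \<sigma>). well_labelled_motzkin n p \<sigma> \<and> horizontal_steps p = k}
    {t. labelled_binary_tree n t \<and> single_leaves t = k}"
proof -
  have tree: "path_tree p \<sigma> (phi p \<sigma>)" if w: "well_labelled_motzkin n p \<sigma>" for p \<sigma>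
  proof -
    have w': "motzkin p" "compatible p \<sigma>" "distinct \<sigma>" "set \<sigma> = {1..length \<sigma>}"
      using w well_labelled_motzkin_iff[OF assms] by auto
    then obtain t where "path_tree p \<sigma> t" using path_tree_of_path by blast
    with w'(4) show ?thesis using phi_path_tree by simp
  qed
  show ?thesis unfolding bij_betw_def
  proof
    show "inj_on (\<lambda>(p, \<sigma>). phi p \<sigma>) {(p, \<sigma>). well_labelled_motzkin n p \<sigma> \<and> horizontal_steps p = k}"
    proof (rule inj_onI, clarsimp)
      fix p \<sigma> p' \<sigma>'
      assume w: "well_labelled_motzkin n p \<sigma>" "well_labelled_motzkin n p' \<sigma>'" "phi p \<sigma> = phi p' \<sigma>'"
      show "p = p' \<and> \<sigma> = \<sigma>'"
        using path_tree_unique[OF tree[OF w(2)]] tree[OF w(1)] w(3) by simp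
    qed
  next
    show "(\<lambda>(p, \<sigma>). phi p \<sigma>) ` {(p, \<sigma>). well_labelled_motzkin n p \<sigma> \<and> horizontal_steps p = k}
      = {t. labelled_binary_tree n t \<and> single_leaves t = k}" (is "?f ` ?A = ?B")
    proof
      show "?f ` ?A \<subseteq> ?B"
      proof clarsimp
        fix p \<sigma> assume w: "well_labelled_motzkin n p \<sigma>"
        have "length (leaves (phi p \<sigma>)) = n" using path_tree_tree[OF tree[OF w]] w
          by (metis card_atLeastAtMost diff_Suc_1 distinct_card well_labelled_motzkin_iff[OF assms])
        then show "labelled_binary_tree n (phi p \<sigma>) \<and> single_leaves (phi p \<sigma>) = horizontal_steps p"
          using path_tree_tree[OF tree[OF w]] w well_labelled_motzkin_iff[OF assms]
          by (auto simp: labelled_binary_tree_def)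
      qed
      show "?B \<subseteq> ?f ` ?A"
      proof
        fix t assume "t \<in> ?B"
        then have t: "canonical t" "distinct (leaves t)" "set (leaves t) = {1..n}" "length (leaves t) = n"
          "single_leaves t = k" by (auto simp: labelled_binary_tree_def)
        then have "\<not> is_leaf t" using assms by (cases t) auto
        then obtain p \<sigma> where ps: "path_tree p \<sigma> t" using path_tree_of_tree t by blast
        note tt = path_tree_tree[OF ps]
        have "length \<sigma> = n" using path_tree_path[OF ps] tt t(3)
          by (metis card_atLeastAtMost diff_Suc_1 distinct_card)
        then have "phi p \<sigma> = t" "well_labelled_motzkin n p \<sigma>" "horizontal_steps p = k"
          using phi_path_tree[OF ps] path_tree_path[OF ps] tt t well_labelled_motzkin_iff[OF assms] by auto
        then show "t \<in> ?f ` ?A" by force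
      qed
    qed
  qed
qed

section \<open>Positions and greedy labellings\<close>

definition positions :: "ltree \<Rightarrow> bool list set" where
  "positions t = {q. subtree_at t q \<noteq> None}"

lemma positions_simps:
  "positions (Leaf a) = {[]}"
  "positions (Node l r) = insert [] (Cons False ` positions l \<union> Cons True ` positions r)"
proof -
  show "positions (Leaf a) = {[]}"
    by (auto simp: positions_def neq_Nil_conv) (metis option.distinct(1) subtree_at.simps(2) neq_Nil_conv)
  have "q \<in> positions (Node l r) \<longleftrightarrow> q \<in> insert [] (Cons False ` positions l \<union> Cons True ` positions r)" for q
  proof (cases q)
    case (Cons b q')
    then show ?thesis by (cases b) (auto simp: positions_def)
  qed (simp add: positions_def)
  then show "positions (Node l r) = insert [] (Cons False ` positions l \<union> Cons True ` positions r)" by blast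
qed

lemma finite_positions [simp]: "finite (positions t)"
  by (induction t) (auto simp: positions_simps)

lemma Nil_in_positions [simp]: "[] \<in> positions t"
  by (simp add: positions_def)

lemma card_positions: "Suc (card (positions t)) = 2 * length (leaves t)"
proof (induction t)
  case (Node l r)
  have "card (positions (Node l r)) = Suc (card (Cons False ` positions l \<union> Cons True ` positions r))"
    unfolding positions_simps by (subst card_insert_disjoint) auto
  also have "card (Cons False ` positions l \<union> Cons True ` positions r) = card (positions l) + card (positions r)"
    by (subst card_Un_disjoint) (auto simp: card_image)
  finally show ?case using Node by simp
qed (simp add: positions_simps)

lemma subtree_at_append:
  "subtree_at t (q @ q') = (case subtree_at t q of None \<Rightarrow> None | Some s \<Rightarrow> subtree_at s q')"
  by (induction t q rule: subtree_at.induct) auto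

lemma subtree_at_snoc:
  "subtree_at t (q @ [b]) = Some s \<longleftrightarrow> (\<exists>l r. subtree_at t q = Some (Node l r) \<and> s = (if b then r else l))"
proof (cases "subtree_at t q")
  case (Some u)
  then show ?thesis by (cases u) (auto simp: subtree_at_append)
qed (simp add: subtree_at_append)

lemma Leaf_subtree: "subtree_at (Leaf x) q = Some s \<Longrightarrow> q = [] \<and> s = Leaf x"
  by (cases q) auto

lemma set_leaves: "a \<in> set (leaves t) \<longleftrightarrow> (\<exists>q. subtree_at t q = Some (Leaf a))"
proof (induction t)
  case (Leaf x)
  show ?case using Leaf_subtree[of x _ "Leaf a"] by (auto intro: exI[of _ "[]"])
next
  case (Node l r)
  have "(\<exists>q. subtree_at (Node l r) q = Some (Leaf a)) \<longleftrightarrow>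
      (\<exists>q. subtree_at l q = Some (Leaf a)) \<or> (\<exists>q. subtree_at r q = Some (Leaf a))" (is "?L = ?R")
  proof
    assume ?L
    then obtain q where q: "subtree_at (Node l r) q = Some (Leaf a)" ..
    then show ?R by (cases q) (auto split: if_splits)
  next
    assume ?R
    then show ?L
    proof
      assume "\<exists>q. subtree_at l q = Some (Leaf a)"
      then obtain q where "subtree_at l q = Some (Leaf a)" ..
      then have "subtree_at (Node l r) (False # q) = Some (Leaf a)" by simp
      then show ?thesis ..
    next
      assume "\<exists>q. subtree_at r q = Some (Leaf a)"
      then obtain q where "subtree_at r q = Some (Leaf a)" ..
      then have "subtree_at (Node l r) (True # q) = Some (Leaf a)" by simp
      then show ?thesis ..
    qed
  qed
  with Node show ?case by simp
qed

text \<open>Turns distinctness into injectivity over positions, the form in which it is used for the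
  initial labels and obtained for the rebuilt tree.\<close>

lemma distinct_leaves_iff:
  "distinct (leaves t) \<longleftrightarrow>
    (\<forall>a q q'. subtree_at t q = Some (Leaf a) \<longrightarrow> subtree_at t q' = Some (Leaf a) \<longrightarrow> q = q')"
proof (induction t)
  case (Leaf x)
  show ?case using Leaf_subtree by (metis distinct_singleton leaves.simps(1))
next
  case (Node l r)
  show ?case (is "?D \<longleftrightarrow> ?U")
  proof
    assume D: ?D
    show ?U
    proof (intro allI impI)
      fix a q q' assume q: "subtree_at (Node l r) q = Some (Leaf a)" "subtree_at (Node l r) q' = Some (Leaf a)"
      obtain b u where u: "q = b # u" "subtree_at (if b then r else l) u = Some (Leaf a)"
        using q(1) by (cases q) auto
      obtain b' u' where u': "q' = b' # u'" "subtree_at (if b' then r else l) u' = Some (Leaf a)"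
        using q(2) by (cases q') auto
      have "a \<in> set (leaves (if b then r else l))" "a \<in> set (leaves (if b' then r else l))"
        using u(2) u'(2) set_leaves by blast+
      then have "b' = b" using D by (auto split: if_splits)
      moreover have "u' = u" using u(2) u'(2) D Node \<open>b' = b\<close> by (auto split: if_splits)
      ultimately show "q = q'" using u u' by simp
    qed
  next
    assume U: ?U
    have 1: "distinct (leaves l)" unfolding Node(1)
    proof (intro allI impI)
      fix a q q' assume "subtree_at l q = Some (Leaf a)" "subtree_at l q' = Some (Leaf a)"
      then show "q = q'" using U[rule_format, of "False # q" a "False # q'"] by simp
    qed
    have 2: "distinct (leaves r)" unfolding Node(2)
    proof (intro allI impI)
      fix a q q' assume "subtree_at r q = Some (Leaf a)" "subtree_at r q' = Some (Leaf a)"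
      then show "q = q'" using U[rule_format, of "True # q" a "True # q'"] by simp
    qed
    have "a \<notin> set (leaves r)" if "a \<in> set (leaves l)" for a
    proof
      assume "a \<in> set (leaves r)"
      then obtain q' where "subtree_at r q' = Some (Leaf a)" unfolding set_leaves ..
      moreover obtain q where "subtree_at l q = Some (Leaf a)" using \<open>a \<in> set (leaves l)\<close> unfolding set_leaves ..
      ultimately
      show False using U[rule_format, of "False # q" a "True # q'"] by simp
    qed
    then show ?D using 1 2 by auto
  qed
qed

definition single_positions :: "ltree \<Rightarrow> bool list set" where
  "single_positions t = {q @ [b] | q b. \<exists>a l r. subtree_at t (q @ [b]) = Some (Leaf a)
     \<and> subtree_at t (q @ [\<not> b]) = Some (Node l r)}"

lemma single_positions_subset: "single_positions t \<subseteq> positions t"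
  by (auto simp: single_positions_def positions_def)

text \<open>The root adds at most one position of length one; all others come from a subtree with
  one direction prepended. These three sets are disjoint.\<close>

lemma card_single_positions: "card (single_positions t) = single_leaves t"
proof (induction t)
  case (Leaf x)
  have "single_positions (Leaf x) = {}"
    unfolding single_positions_def by (auto simp: subtree_at_snoc dest: Leaf_subtree)
  then show ?case by simp
next
  case (Node l r)
  let ?R = "{[b] | b. is_leaf (if b then r else l) \<and> \<not> is_leaf (if b then l else r)}"
  have dec: "single_positions (Node l r) =
      ?R \<union> (Cons False ` single_positions l \<union> Cons True ` single_positions r)" (is "?A = ?B")
  proof
    show "?A \<subseteq> ?B"
    proof
      fix x assume "x \<in> ?A"
      then obtain q b a u v where x: "x = q @ [b]" "subtree_at (Node l r) (q @ [b]) = Some (Leaf a)"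
        "subtree_at (Node l r) (q @ [\<not> b]) = Some (Node u v)" unfolding single_positions_def by blast
      show "x \<in> ?B"
      proof (cases q)
        case Nil
        with x show ?thesis by (cases b) auto
      next
        case (Cons c q')
        with x have "subtree_at (if c then r else l) (q' @ [b]) = Some (Leaf a)"
          "subtree_at (if c then r else l) (q' @ [\<not> b]) = Some (Node u v)" by auto
        then have "q' @ [b] \<in> single_positions (if c then r else l)" unfolding single_positions_def by blast
        with x Cons show ?thesis by (cases c) auto
      qed
    qed
    show "?B \<subseteq> ?A"
    proof
      fix x assume "x \<in> ?B"
      then consider b where "x = [b]" "is_leaf (if b then r else l)" "\<not> is_leaf (if b then l else r)"
        | c y where "x = c # y" "y \<in> single_positions (if c then r else l)" by force
      then show "x \<in> ?A"
      proof cases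
        case 1
        obtain a where a: "(if b then r else l) = Leaf a" using 1(2) by (cases "if b then r else l") auto
        obtain u v where uv: "(if b then l else r) = Node u v" using 1(3) by (cases "if b then l else r") auto
        have "subtree_at (Node l r) ([] @ [b]) = Some (Leaf a)" "subtree_at (Node l r) ([] @ [\<not> b]) = Some (Node u v)"
          using a uv by auto
        then show ?thesis using 1(1) unfolding single_positions_def by blast
      next
        case 2
        then obtain q b a u v where y: "y = q @ [b]" "subtree_at (if c then r else l) (q @ [b]) = Some (Leaf a)"
          "subtree_at (if c then r else l) (q @ [\<not> b]) = Some (Node u v)" unfolding single_positions_def by blast
        then have "subtree_at (Node l r) ((c # q) @ [b]) = Some (Leaf a)"
          "subtree_at (Node l r) ((c # q) @ [\<not> b]) = Some (Node u v)" "x = (c # q) @ [b]" using 2(1) by auto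
        then show ?thesis unfolding single_positions_def by blast
      qed
    qed
  qed
  have fin: "finite (single_positions t)" for t using finite_subset[OF single_positions_subset] by simp
  have ne: "[] \<notin> single_positions t" for t by (auto simp: single_positions_def)
  \<comment> \<open>If exactly one child of the root is a leaf, its direction is \<open>True\<close>
    exactly when that child is \<open>r\<close>.\<close>
  have R: "?R = (if is_leaf l = is_leaf r then {} else {[is_leaf r]})" by auto
  have "card (single_positions (Node l r)) =
      card ?R + card (Cons False ` single_positions l \<union> Cons True ` single_positions r)"
    unfolding dec R using fin ne by (subst card_Un_disjoint) auto
  also have "card (Cons False ` single_positions l \<union> Cons True ` single_positions r)
      = card (single_positions l) + card (single_positions r)"
    using fin by (subst card_Un_disjoint) (auto simp: card_image)
  finally show ?case using Node R by simp
qed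

text \<open>The states of the labelling loop of \<open>\<Psi>\<close> in which the labels \<open>1, \<dots>, m\<close> have been used.\<close>

locale greedy_labelling =
  fixes t :: ltree and m :: nat and lab :: "bool list \<Rightarrow> nat option"
  assumes dom: "lab q = Some v \<Longrightarrow> q \<noteq> [] \<and> q \<in> positions t"
    and leaf: "subtree_at t q = Some (Leaf a) \<Longrightarrow> lab q = Some a"
    and inj: "lab q = Some v \<Longrightarrow> lab q' = Some v \<Longrightarrow> q = q'"
    and ran: "ran lab = {1..m}"
    and internal: "internal_nonroot t q \<Longrightarrow> lab q = Some v \<Longrightarrow> length (leaves t) < v"
    and children: "internal_nonroot t q \<Longrightarrow> lab q = Some v
      \<Longrightarrow> \<exists>a b. lab (q @ [False]) = Some a \<and> lab (q @ [True]) = Some b \<and> a < v \<and> b < v"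
    and greedy: "internal_nonroot t q \<Longrightarrow> lab q = Some v
      \<Longrightarrow> lab (q @ [False]) = Some a \<Longrightarrow> lab (q @ [True]) = Some b
      \<Longrightarrow> internal_nonroot t q' \<Longrightarrow> lab q' = None \<or> (\<exists>w>v. lab q' = Some w)
      \<Longrightarrow> lab (q' @ [False]) = Some a' \<Longrightarrow> lab (q' @ [True]) = Some b' \<Longrightarrow> a' < v \<Longrightarrow> b' < v
      \<Longrightarrow> min a b < min a' b'"
begin

lemma lab_range: "lab q = Some v \<Longrightarrow> v \<in> {1..m}"
  using ran ranI by fastforce

lemma lab_surj: "v \<in> {1..m} \<Longrightarrow> \<exists>q. lab q = Some v"
  using ran by (auto simp: ran_def)

text \<open>Counting vertices tells how far the loop has come: \<open>m\<close> is below the number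
  of non-root vertices while one of them waits, and equal to it at the end.\<close>

lemma m_eq_card: "m = card {q. lab q \<noteq> None}"
proof -
  have "bij_betw (\<lambda>q. the (lab q)) {q. lab q \<noteq> None} {1..m}"
    unfolding bij_betw_def
  proof
    show "inj_on (\<lambda>q. the (lab q)) {q. lab q \<noteq> None}" using inj by (auto simp: inj_on_def)
    show "(\<lambda>q. the (lab q)) ` {q. lab q \<noteq> None} = {1..m}" unfolding ran[symmetric]
      by (force simp: ran_def)
  qed
  then show ?thesis by (simp add: bij_betw_same_card)
qed

end

section \<open>The labelling loop and its final state\<close>

lemma internal_nonroot_or_leaf:
  assumes "q \<noteq> []" and "q \<in> positions t"
  shows "internal_nonroot t q \<or> (\<exists>a. subtree_at t q = Some (Leaf a))"
proof -
  obtain s where "subtree_at t q = Some s" using assms(2) by (auto simp: positions_def)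
  with assms(1) show ?thesis by (cases s) (auto simp: internal_nonroot_def)
qed

lemma internal_nonroot_positions: "internal_nonroot t q \<Longrightarrow> q \<in> positions t"
  by (auto simp: internal_nonroot_def positions_def)

lemma child_in_positions: "internal_nonroot t q \<Longrightarrow> q @ [b] \<in> positions t"
  by (auto simp: internal_nonroot_def positions_def subtree_at_append)

lemma card_nonroot: "card (positions t - {[]}) = 2 * length (leaves t) - 2"
  using card_positions[of t] by simp

text \<open>Only leaves are labelled so far, so the three clauses about labelled internal vertices
  hold vacuously.\<close>

lemma greedy_labelling_initial:
  assumes "labelled_binary_tree n t" and "2 \<le> n"
  shows "greedy_labelling t n (initial_labels t)"
proof
  have len: "length (leaves t) = n" and d: "distinct (leaves t)" and s: "set (leaves t) = {1..n}"
    using assms(1) by (auto simp: labelled_binary_tree_def)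
  have lf: "initial_labels t q = Some v \<longleftrightarrow> subtree_at t q = Some (Leaf v)" for q v
    by (auto simp: initial_labels_def split: option.splits ltree.splits)
  show "q \<noteq> [] \<and> q \<in> positions t" if "initial_labels t q = Some v" for q v
    using that len assms(2) unfolding lf by (auto simp: positions_def)
  show "initial_labels t q = Some a" if "subtree_at t q = Some (Leaf a)" for q a
    using that lf by blast
  show "q = q'" if "initial_labels t q = Some v" "initial_labels t q' = Some v" for q q' v
    using that d unfolding lf distinct_leaves_iff by blast
  show "ran (initial_labels t) = {1..n}" using s set_leaves by (auto simp: ran_def lf)
  have *: False if "internal_nonroot t q" "initial_labels t q = Some v" for q v
    using that unfolding lf by (auto simp: internal_nonroot_def)
  show "length (leaves t) < v" if "internal_nonroot t q" "initial_labels t q = Some v" for q v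
    using * that by blast
  show "\<exists>a b. initial_labels t (q @ [False]) = Some a \<and> initial_labels t (q @ [True]) = Some b \<and> a < v \<and> b < v"
    if "internal_nonroot t q" "initial_labels t q = Some v" for q v
    using * that by blast
  show "min a b < min a' b'"
    if "internal_nonroot t q" "initial_labels t q = Some v" for q v and a b a' b' :: nat
    using * that by blast
qed

text \<open>The \<open>THE\<close> and the \<open>LEAST\<close> in \<open>psi_step\<close> must be
  shown to denote: a candidate exists, its least child label identifies it, and \<open>Suc m\<close>
  is the next free label.\<close>

lemma greedy_labelling_step:
  assumes "greedy_labelling t m lab" and n: "length (leaves t) \<le> m"
    and unlab: "internal_nonroot t q" "lab q = None"
  shows "\<exists>q0. psi_step t lab = lab(q0 := Some (Suc m)) \<and> internal_nonroot t q0 \<and> lab q0 = None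
    \<and> greedy_labelling t (Suc m) (psi_step t lab)"
proof -
  interpret greedy_labelling t m lab by fact
  define C where "C = {q. internal_nonroot t q \<and> lab q = None \<and>
                 lab (q @ [False]) \<noteq> None \<and> lab (q @ [True]) \<noteq> None}"
  define mc where "mc q = min (the (lab (q @ [False]))) (the (lab (q @ [True])))" for q
  have finC: "finite C" using finite_subset[of C "positions t"] internal_nonroot_positions
    by (auto simp: C_def)
  \<comment> \<open>A deepest unlabelled internal vertex has two labelled children.\<close>
  have "C \<noteq> {}"
  proof -
    let ?U = "{q. internal_nonroot t q \<and> lab q = None}"
    have finU: "finite ?U" using finite_subset[of ?U "positions t"] internal_nonroot_positions by auto
    have "?U \<noteq> {}" using unlab by auto
    then have "Max (length ` ?U) \<in> length ` ?U" using finU by (intro Max_in) auto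
    then obtain u where u: "u \<in> ?U" "length u = Max (length ` ?U)" by force
    then have mx: "length v \<le> length u" if "v \<in> ?U" for v
      unfolding u(2) using finU that by (intro Max_ge) auto
    have "lab (u @ [b]) \<noteq> None" for b
    proof -
      have "u @ [b] \<in> positions t" using u child_in_positions by blast
      then have "internal_nonroot t (u @ [b]) \<or> (\<exists>a. subtree_at t (u @ [b]) = Some (Leaf a))"
        using internal_nonroot_or_leaf by blast
      moreover have "u @ [b] \<notin> ?U" using mx by fastforce
      ultimately show ?thesis using leaf by auto
    qed
    then have "u \<in> C" using u by (auto simp: C_def)
    then show ?thesis by blast
  qed
  \<comment> \<open>The least child label determines the child by injectivity, and the child
    determines its parent; so the minimiser is unique and later comparisons are strict.\<close>
  have mc_inj: "p = p'" if pp: "p \<in> C" "p' \<in> C" "mc p = mc p'" for p p'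
  proof -
    have ex: "\<exists>b. lab (u @ [b]) = Some (mc u)" if u: "u \<in> C" for u
    proof -
      obtain x y where "lab (u @ [False]) = Some x" "lab (u @ [True]) = Some y"
        using u by (auto simp: C_def)
      then show ?thesis by (cases "x \<le> y") (auto simp: mc_def min_def)
    qed
    obtain b b' where "lab (p @ [b]) = Some (mc p)" "lab (p' @ [b']) = Some (mc p)"
      using ex[OF pp(1)] ex[OF pp(2)] pp(3) by auto
    from inj[OF this] show ?thesis by simp
  qed
  have "Min (mc ` C) \<in> mc ` C" using finC \<open>C \<noteq> {}\<close> by (intro Min_in) auto
  then obtain q0 where q0: "q0 \<in> C" and q0m: "mc q0 = Min (mc ` C)" by force
  have q0min: "mc q0 \<le> mc q'" if "q' \<in> C" for q'
    unfolding q0m using finC that by (intro Min_le) auto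
  have the_q0: "(THE q. q \<in> C \<and> (\<forall>q'\<in>C. mc q \<le> mc q')) = q0"
    using q0 q0min mc_inj by (intro the_equality) (blast intro: antisym)+
  have "m < 2 * length (leaves t) - 2"
  proof -
    have "q \<in> positions t - {[]}" using unlab internal_nonroot_positions by (auto simp: internal_nonroot_def)
    then have "{q. lab q \<noteq> None} \<subset> positions t - {[]}" using dom unlab by blast
    from psubset_card_mono[OF _ this] show ?thesis using m_eq_card card_nonroot[of t] by simp
  qed
  then have the_l: "(LEAST l. l \<in> {1..2 * length (leaves t) - 2} - {1..length (leaves t)} \<and> l \<notin> ran lab) = Suc m"
    using n unfolding ran by (intro Least_equality) auto
  have step: "psi_step t lab = lab(q0 := Some (Suc m))"
    unfolding psi_step_def Let_def C_def[symmetric] mc_def[symmetric] the_q0 the_l ..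
  have q0C: "internal_nonroot t q0" "lab q0 = None" using q0 by (auto simp: C_def)
  define lab' where "lab' = lab(q0 := Some (Suc m))"
  have old: "lab' p = Some v \<longleftrightarrow> lab p = Some v" if "v \<le> m" for p v
    using that q0C by (auto simp: lab'_def)
  have new: "lab' p = Some v \<Longrightarrow> v = Suc m \<and> p = q0 \<or> v \<le> m \<and> lab p = Some v" for p v
    using lab_range[of p v] by (auto simp: lab'_def split: if_splits)
  have keep: "lab p = Some v \<Longrightarrow> lab' p = Some v" for p v using q0C by (auto simp: lab'_def)
  have "greedy_labelling t (Suc m) lab'"
  proof
    show "q \<noteq> [] \<and> q \<in> positions t" if "lab' q = Some v" for q v
      using new[OF that] dom q0C internal_nonroot_positions by (auto simp: internal_nonroot_def)
    show "lab' q = Some a" if "subtree_at t q = Some (Leaf a)" for q a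
      using leaf[OF that] keep by blast
    show "q = q'" if "lab' q = Some v" "lab' q' = Some v" for q q' v
      using new[OF that(1)] new[OF that(2)] inj by auto
    show "ran lab' = {1..Suc m}" using ran q0C by (auto simp: lab'_def)
    show "length (leaves t) < v" if "internal_nonroot t q" "lab' q = Some v" for q v
      using new[OF that(2)] that(1) internal n by auto
    show "\<exists>a b. lab' (q @ [False]) = Some a \<and> lab' (q @ [True]) = Some b \<and> a < v \<and> b < v"
      if "internal_nonroot t q" "lab' q = Some v" for q v
      using new[OF that(2)]
    proof
      assume v: "v = Suc m \<and> q = q0"
      then obtain a b where "lab (q @ [False]) = Some a" "lab (q @ [True]) = Some b"
        using q0 by (auto simp: C_def)
      then show ?thesis using keep lab_range v by fastforce
    next
      assume "v \<le> m \<and> lab q = Some v"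
      then show ?thesis using children[OF that(1)] keep by blast
    qed
    show "min a b < min a' b'"
      if h: "internal_nonroot t q" "lab' q = Some v" "lab' (q @ [False]) = Some a" "lab' (q @ [True]) = Some b"
        "internal_nonroot t q'" "lab' q' = None \<or> (\<exists>w>v. lab' q' = Some w)"
        "lab' (q' @ [False]) = Some a'" "lab' (q' @ [True]) = Some b'" "a' < v" "b' < v"
      for q v a b q' a' b'
    proof -
      have vm: "v \<le> Suc m" using new[OF h(2)] by auto
      then have ch': "lab (q' @ [False]) = Some a'" "lab (q' @ [True]) = Some b'"
        using h(7-10) old by auto
      from new[OF h(2)] show ?thesis
      proof
        assume v: "v = Suc m \<and> q = q0"
        \<comment> \<open>No label exceeds \<open>Suc m\<close>, so \<open>q'\<close> is still
          unlabelled and was a competitor of \<open>q0\<close> in this round.\<close>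
        then have "lab' q' = None" using h(6) new by fastforce
        then have q': "q' \<noteq> q0" "lab q' = None" by (auto simp: lab'_def split: if_splits)
        then have q'C: "q' \<in> C" using h(5) ch' by (simp add: C_def)
        have "q0 @ [c] \<noteq> q0" for c by simp
        then have "lab (q @ [False]) = Some a" "lab (q @ [True]) = Some b"
          using h(3,4) v by (auto simp: lab'_def)
        then have "mc q0 = min a b" "mc q' = min a' b'" using v ch' by (auto simp: mc_def)
        moreover have "mc q0 < mc q'" using q0min[OF q'C] mc_inj[OF q0 q'C] q' by fastforce
        ultimately show ?thesis by simp
      next
        assume v: "v \<le> m \<and> lab q = Some v"
        obtain a0 b0 where ab: "lab (q @ [False]) = Some a0" "lab (q @ [True]) = Some b0"
          using children[OF h(1)] v by blast
        then have "a0 = a" "b0 = b" using keep h(3,4) by fastforce+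
        \<comment> \<open>If \<open>q'\<close> is the vertex just labelled, it was unlabelled
          before; otherwise its label has not changed.\<close>
        moreover have "lab q' = None \<or> (\<exists>w>v. lab q' = Some w)"
          using h(6) q0C by (auto simp: lab'_def split: if_splits)
        ultimately show ?thesis using greedy[OF h(1) _ _ _ h(5) _ ch' h(9,10)] ab v by blast
      qed
    qed
  qed
  then show ?thesis using step q0C unfolding lab'_def by auto
qed

lemma greedy_labelling_psi_labels:
  assumes t: "labelled_binary_tree n t" and n: "2 \<le> n"
  shows "greedy_labelling t (2 * n - 2) (psi_labels t)"
proof -
  have len: "length (leaves t) = n" using t by (simp add: labelled_binary_tree_def)
  let ?U = "\<lambda>lab. {q. internal_nonroot t q \<and> lab q = None}"
  have fin: "finite (?U lab)" for lab :: "bool list \<Rightarrow> nat option"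
    using finite_subset[of "?U lab" "positions t"] internal_nonroot_positions by auto
  show ?thesis unfolding psi_labels_def
  \<comment> \<open>The invariant leaves \<open>m\<close> existential since it grows in each round;
    \<open>m_eq_card\<close> determines it at the exit.\<close>
  proof (rule while_rule[where P = "\<lambda>lab. \<exists>m\<ge>n. greedy_labelling t m lab" and r = "measure (\<lambda>lab. card (?U lab))"])
    show "\<exists>m\<ge>n. greedy_labelling t m (initial_labels t)" using greedy_labelling_initial[OF t n] by blast
  next
    fix lab assume "\<exists>m\<ge>n. greedy_labelling t m lab" "\<exists>q. internal_nonroot t q \<and> lab q = None"
    then obtain m q where m: "m \<ge> n" "greedy_labelling t m lab" "internal_nonroot t q" "lab q = None" by blast
    from greedy_labelling_step[OF m(2) _ m(3,4)] m(1) len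
    obtain q0 where q0: "psi_step t lab = lab(q0 := Some (Suc m))" "internal_nonroot t q0" "lab q0 = None"
      "greedy_labelling t (Suc m) (psi_step t lab)" by auto
    then show "\<exists>m\<ge>n. greedy_labelling t m (psi_step t lab)" using m(1) by (intro exI[of _ "Suc m"]) simp
    have "?U (psi_step t lab) \<subset> ?U lab" using q0 by (auto split: if_splits)
    then show "(psi_step t lab, lab) \<in> measure (\<lambda>lab. card (?U lab))"
      using psubset_card_mono[OF fin] by simp
  next
    fix lab assume "\<exists>m\<ge>n. greedy_labelling t m lab" and all: "\<not> (\<exists>q. internal_nonroot t q \<and> lab q = None)"
    then obtain m where m: "greedy_labelling t m lab" by blast
    interpret greedy_labelling t m lab by fact
    have "lab q \<noteq> None" if "q \<in> positions t - {[]}" for q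
      using internal_nonroot_or_leaf[of q t] that all leaf[of q] by auto
    then have "{q. lab q \<noteq> None} = positions t - {[]}" using dom by auto
    then have "m = 2 * n - 2" using m_eq_card card_nonroot[of t] len by simp
    then show "greedy_labelling t (2 * n - 2) lab" using m by simp
  qed simp
qed

text \<open>If two greedy labellings agree below \<open>v\<close> but put \<open>v\<close> at different vertices, then each of these
  vertices was available when the other was chosen, so each has the strictly smaller child.\<close>

lemma greedy_labelling_unique:
  assumes "greedy_labelling t m lab" and "greedy_labelling t m lab'"
  shows "lab = lab'"
proof -
  have agree: "\<forall>q. lab q = Some v \<longleftrightarrow> lab' q = Some v" for v
  proof (induction v rule: less_induct)
    case (less v)
    have half: "L' q = Some v"
      if G: "greedy_labelling t m L" "greedy_labelling t m L'" and q: "L q = Some v"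
        and IH: "\<And>w q. w < v \<Longrightarrow> L q = Some w \<longleftrightarrow> L' q = Some w" for L L' q
    proof -
      interpret a: greedy_labelling t m L by fact
      interpret b: greedy_labelling t m L' by fact
      from a.dom[OF q] internal_nonroot_or_leaf
      consider a where "subtree_at t q = Some (Leaf a)" | "internal_nonroot t q" by blast
      then show ?thesis
      proof cases
        case 1
        then show ?thesis using a.leaf b.leaf q by force
      next
        case int: 2
        obtain q' where q': "L' q' = Some v" using b.lab_surj a.lab_range[OF q] by blast
        have "\<not> (\<exists>a. subtree_at t q' = Some (Leaf a))"
          using a.leaf b.leaf a.inj q q' int by (metis internal_nonroot_def ltree.distinct(1) option.inject)
        then have int': "internal_nonroot t q'" using internal_nonroot_or_leaf b.dom[OF q'] by blast
        obtain x y where xy: "L (q @ [False]) = Some x" "L (q @ [True]) = Some y" "x < v" "y < v"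
          using a.children[OF int q] by blast
        obtain x' y' where xy': "L' (q' @ [False]) = Some x'" "L' (q' @ [True]) = Some y'" "x' < v" "y' < v"
          using b.children[OF int' q'] by blast
        show ?thesis
        proof (rule ccontr)
          assume ne: "L' q \<noteq> Some v"
          \<comment> \<open>A label of \<open>q'\<close> below \<open>v\<close> would be shared by
            \<open>L'\<close> by the induction hypothesis, but \<open>L'\<close> puts
            \<open>v\<close> there.\<close>
          have free: "L q' = None \<or> (\<exists>w>v. L q' = Some w)"
          proof (cases "L q'")
            case (Some w)
            have "w \<noteq> v" using a.inj[OF q] Some ne q' by auto
            moreover have "\<not> w < v" using IH[of w q'] Some q' by auto
            ultimately show ?thesis using Some by auto
          qed simp
          have free': "L' q = None \<or> (\<exists>w>v. L' q = Some w)"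
          proof (cases "L' q")
            case (Some w)
            have "\<not> w < v" using IH[of w q] Some q by auto
            then show ?thesis using Some ne by auto
          qed simp
          have "min x y < min x' y'"
            using a.greedy[OF int q xy(1,2) int' free _ _ xy'(3,4)] IH xy' by blast
          moreover have "min x' y' < min x y"
            using b.greedy[OF int' q' xy'(1,2) int free' _ _ xy(3,4)] IH xy by blast
          ultimately show False by (rule less_asym)
        qed
      qed
    qed
    show ?case using half[OF assms] half[OF assms(2,1)] less by blast
  qed
  show ?thesis
  proof
    fix q show "lab q = lab' q" using agree by (metis not_None_eq)
  qed
qed

section \<open>Matchings\<close>

text \<open>The pairs of a matching \<open>f\<close> on \<open>[2n-2]\<close> are the sibling pairs of a tree, \<open>par i\<close> is the label of
  the parent of \<open>i\<close>, and the root is given the label \<open>2n-1\<close>, which the procedure would assign next.\<close>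

locale greedy_parents =
  fixes n :: nat and f par :: "nat \<Rightarrow> nat"
  assumes two_le: "2 \<le> n"
    and matching: "matching (2 * n - 2) f"
    and par_range: "i \<in> {1..2 * n - 2} \<Longrightarrow> par i \<in> {n + 1..2 * n - 1}"
    and par_f: "i \<in> {1..2 * n - 2} \<Longrightarrow> par (f i) = par i"
    and par_less: "i \<in> {1..2 * n - 2} \<Longrightarrow> i < par i"
    and par_eq: "i \<in> {1..2 * n - 2} \<Longrightarrow> j \<in> {1..2 * n - 2} \<Longrightarrow> par i = par j \<Longrightarrow> j = i \<or> j = f i"
    and par_surj: "v \<in> {n + 1..2 * n - 1} \<Longrightarrow> \<exists>i\<in>{1..2 * n - 2}. par i = v"
    and par_greedy: "i \<in> {1..2 * n - 2} \<Longrightarrow> j \<in> {1..2 * n - 2} \<Longrightarrow> par i < par j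
      \<Longrightarrow> j < par i \<Longrightarrow> f j < par i \<Longrightarrow> min i (f i) < min j (f j)"

lemma matchingD:
  assumes "matching m f" and "i \<in> {1..m}"
  shows "f i \<in> {1..m}" "f (f i) = i" "f i \<noteq> i"
  using assms by (auto simp: matching_def)

text \<open>The exchange argument of \<open>greedy_labelling_unique\<close> with the pairs
  \<open>{i, f i}\<close> in place of vertices. That the rival pair was available in time is
  \<open>par_less\<close> for the other parent function.\<close>

lemma greedy_parents_unique:
  assumes "greedy_parents n f par" and "greedy_parents n f par'" and "i \<in> {1..2 * n - 2}"
  shows "par i = par' i"
proof -
  have agree: "\<forall>i\<in>{1..2 * n - 2}. par i = v \<longleftrightarrow> par' i = v" for v
  proof (induction v rule: less_induct)
    case (less v)
    have half: "P' i = v"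
      if G: "greedy_parents n f P" "greedy_parents n f P'" and i: "i \<in> {1..2 * n - 2}" "P i = v"
        and IH: "\<And>w i. w < v \<Longrightarrow> i \<in> {1..2 * n - 2} \<Longrightarrow> P i = w \<longleftrightarrow> P' i = w" for P P' i
    proof (rule ccontr)
      assume ne: "P' i \<noteq> v"
      interpret a: greedy_parents n f P by fact
      interpret b: greedy_parents n f P' by fact
      obtain i' where i': "i' \<in> {1..2 * n - 2}" "P' i' = v" using b.par_surj[of v] a.par_range[OF i(1)] i(2) by auto
      have fi: "f i \<in> {1..2 * n - 2}" "f i' \<in> {1..2 * n - 2}" using matchingD[OF a.matching] i i' by auto
      have "P i' \<noteq> v"
        using a.par_eq[OF i(1) i'(1)] i(2) b.par_f[OF i(1)] i'(2) ne by auto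
      moreover have "\<not> P i' < v" using IH[of "P i'" i'] i' by auto
      ultimately have 1: "P i < P i'" using i by simp
      have "\<not> P' i < v" using IH[of "P' i" i] i by auto
      then have 2: "P' i' < P' i" using ne i' by simp
      have "min i (f i) < min i' (f i')"
        using a.par_greedy[OF i(1) i'(1) 1] b.par_less[OF i'(1)] b.par_less[OF fi(2)] b.par_f[OF i'(1)] i i' by simp
      moreover have "min i' (f i') < min i (f i)"
        using b.par_greedy[OF i'(1) i(1) 2] a.par_less[OF i(1)] a.par_less[OF fi(1)] a.par_f[OF i(1)] i i' by simp
      ultimately show False by (rule less_asym)
    qed
    show ?case using half[OF assms(1,2)] half[OF assms(2,1)] less by blast
  qed
  then show ?thesis using assms(3) by blast
qed

section \<open>Greedy parents of an arbitrary matching\<close>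

primrec used :: "nat \<Rightarrow> (nat \<Rightarrow> nat) \<Rightarrow> nat \<Rightarrow> nat set" where
  "used n f 0 = {}"
| "used n f (Suc k) = (let c = (LEAST i. i \<in> {1..n + k} - used n f k \<and> f i \<le> n + k) in {c, f c} \<union> used n f k)"

text \<open>Steps are counted from \<open>0\<close>: at step \<open>k\<close> the labels
  \<open>1..n+k\<close> exist, the pairs consumed earlier form \<open>used n f k\<close>, and the
  parent of the chosen pair becomes \<open>n+k+1\<close>.\<close>

definition pick :: "nat \<Rightarrow> (nat \<Rightarrow> nat) \<Rightarrow> nat \<Rightarrow> nat" where
  "pick n f k = (LEAST i. i \<in> {1..n + k} - used n f k \<and> f i \<le> n + k)"

lemma used_Suc: "used n f (Suc k) = {pick n f k, f (pick n f k)} \<union> used n f k"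
  by (simp add: pick_def Let_def)

declare used.simps(2) [simp del]

lemma used_mono: "k \<le> l \<Longrightarrow> used n f k \<subseteq> used n f l"
  by (rule lift_Suc_mono_le[of "used n f"]) (auto simp: used_Suc)

text \<open>Among the \<open>n - k\<close> labels that are available at step \<open>k\<close> two must be matched to each other, since only
  \<open>n - k - 2\<close> labels are still to come.\<close>

lemma pick_ex:
  assumes f: "matching (2 * n - 2) f" and k: "Suc k < n"
    and U: "used n f k \<subseteq> {1..n + k}" "card (used n f k) = 2 * k"
  shows "\<exists>i. i \<in> {1..n + k} - used n f k \<and> f i \<le> n + k"
proof (rule ccontr)
  assume none: "\<nexists>i. i \<in> {1..n + k} - used n f k \<and> f i \<le> n + k"
  let ?P = "{1..n + k} - used n f k"
  have sub: "?P \<subseteq> {1..2 * n - 2}" using k by auto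
  have "inj_on f ?P" using matchingD(2)[OF f] sub by (intro inj_on_inverseI[of _ f]) blast
  moreover have "f ` ?P \<subseteq> {n + k + 1..2 * n - 2}"
  proof
    fix x assume "x \<in> f ` ?P"
    then obtain i where i: "i \<in> ?P" "x = f i" by blast
    then have "x \<in> {1..2 * n - 2}" using matchingD(1)[OF f] sub by blast
    moreover have "n + k < x" using none i by (meson not_le)
    ultimately show "x \<in> {n + k + 1..2 * n - 2}" by simp
  qed
  ultimately have "card ?P \<le> card {n + k + 1..2 * n - 2}" by (intro card_inj_on_le) auto
  moreover have "card ?P = n + k - 2 * k"
    using U finite_subset[OF U(1)] by (subst card_Diff_subset) auto
  ultimately show False using k by auto
qed

text \<open>Closure under \<open>f\<close> shows that the partner of the chosen label is also new,
  so each step consumes exactly two labels.\<close>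

lemma used_props:
  assumes f: "matching (2 * n - 2) f" and "k < n"
  shows "used n f k \<subseteq> {1..n + k - 1} \<and> card (used n f k) = 2 * k \<and> (\<forall>i\<in>used n f k. f i \<in> used n f k)"
  using assms(2)
proof (induction k)
  case (Suc k)
  then have U: "used n f k \<subseteq> {1..n + k - 1}" "card (used n f k) = 2 * k" "\<forall>i\<in>used n f k. f i \<in> used n f k"
    by auto
  have sub: "used n f k \<subseteq> {1..n + k}" using U(1) by fastforce
  let ?c = "pick n f k"
  have c: "?c \<in> {1..n + k} - used n f k \<and> f ?c \<le> n + k"
    unfolding pick_def using pick_ex[OF f Suc.prems sub U(2)] by (rule LeastI_ex)
  then have cS: "?c \<in> {1..2 * n - 2}" using Suc.prems by auto
  note fc = matchingD[OF f cS]
  have "f ?c \<notin> used n f k" using c U(3) fc(2) by force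
  then have "card (used n f (Suc k)) = 2 * Suc k"
    unfolding used_Suc using c fc U finite_subset[OF sub] by (simp add: card_insert_if)
  moreover have "used n f (Suc k) \<subseteq> {1..n + Suc k - 1}"
    unfolding used_Suc using c fc sub by auto
  moreover have "\<forall>i\<in>used n f (Suc k). f i \<in> used n f (Suc k)"
    unfolding used_Suc using fc U(3) by auto
  ultimately show ?case by blast
qed simp

lemma pick_props:
  assumes f: "matching (2 * n - 2) f" and k: "Suc k < n"
  shows "pick n f k \<in> {1..n + k} - used n f k" "f (pick n f k) \<le> n + k"
    "\<And>i. i \<in> {1..n + k} - used n f k \<Longrightarrow> f i \<le> n + k \<Longrightarrow> pick n f k \<le> i"
proof -
  have U: "used n f k \<subseteq> {1..n + k - 1}" "card (used n f k) = 2 * k" using used_props[OF f, of k] k by auto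
  have sub: "used n f k \<subseteq> {1..n + k}" using U(1) by fastforce
  have "pick n f k \<in> {1..n + k} - used n f k \<and> f (pick n f k) \<le> n + k"
    unfolding pick_def using pick_ex[OF f k sub U(2)] by (rule LeastI_ex)
  then show "pick n f k \<in> {1..n + k} - used n f k" "f (pick n f k) \<le> n + k" by auto
  show "pick n f k \<le> i" if "i \<in> {1..n + k} - used n f k" "f i \<le> n + k" for i
    unfolding pick_def using that by (intro Least_le) blast
qed

text \<open>If a label is first consumed at step \<open>j\<close>, its rank is \<open>j+1\<close>,
  so \<open>n + rank i\<close> is the label created at that step.\<close>

lemma greedy_parents_exist:
  assumes f: "matching (2 * n - 2) f" and n: "2 \<le> n"
  shows "\<exists>par. greedy_parents n f par"
proof -
  define rank where "rank i = (LEAST k. i \<in> used n f k)" for i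
  let ?S = "{1..2 * n - 2}"
  \<comment> \<open>Two labels per step exhaust all \<open>2n-2\<close> labels after
    \<open>n-1\<close> steps; the last step supplies the root label \<open>2n-1\<close>.\<close>
  have all: "used n f (n - 1) = ?S"
  proof (rule card_subset_eq)
    show "used n f (n - 1) \<subseteq> ?S" "card (used n f (n - 1)) = card ?S"
      using used_props[OF f, of "n - 1"] n by (auto simp: numeral_2_eq_2)
  qed simp
  have in_rank: "i \<in> used n f (rank i)" if "i \<in> ?S" for i
    unfolding rank_def using that all by (intro LeastI[of "\<lambda>k. i \<in> used n f k" "n - 1"]) simp
  have rank_le: "rank i \<le> k" if "i \<in> used n f k" for i k
    unfolding rank_def using that by (rule Least_le)
  have rank_Suc: "\<exists>j. rank i = Suc j \<and> Suc j < n \<and> i \<in> {pick n f j, f (pick n f j)}" if i: "i \<in> ?S" for i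
  proof -
    obtain j where j: "rank i = Suc j" using in_rank[OF i] by (cases "rank i") auto
    have "i \<notin> used n f j" using rank_le[of i j] j by auto
    then have "i \<in> {pick n f j, f (pick n f j)}" using in_rank[OF i] unfolding j used_Suc by blast
    moreover have "Suc j < n" using rank_le[of i "n - 1"] i all j n by auto
    ultimately show ?thesis using j by blast
  qed
  have used_f: "f i \<in> used n f k \<longleftrightarrow> i \<in> used n f k" if "i \<in> ?S" "k < n" for i k
    using used_props[OF f that(2)] matchingD(2)[OF f that(1)] by metis
  have rank_f: "rank (f i) = rank i" if i: "i \<in> ?S" for i
  proof (rule antisym)
    have fi: "f i \<in> ?S" using matchingD[OF f i] by blast
    have "rank i < n" "rank (f i) < n" using rank_Suc[OF i] rank_Suc[OF fi] by auto
    then show "rank (f i) \<le> rank i" "rank i \<le> rank (f i)"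
      using in_rank[OF i] in_rank[OF fi] used_f[OF i] rank_le by blast+
  qed
  have pick_S: "pick n f j \<in> ?S" if "Suc j < n" for j
    using pick_props(1)[OF f that] that by auto
  have "greedy_parents n f (\<lambda>i. n + rank i)"
  proof
    fix i assume i: "i \<in> ?S"
    obtain j where j: "rank i = Suc j" "Suc j < n" "i \<in> {pick n f j, f (pick n f j)}"
      using rank_Suc[OF i] by blast
    show "n + rank i \<in> {n + 1..2 * n - 1}" using j by auto
    show "n + rank (f i) = n + rank i" using rank_f[OF i] by simp
    show "i < n + rank i" using j pick_props(1,2)[OF f j(2)] by auto
    fix i' assume i': "i' \<in> ?S"
    show "i' = i \<or> i' = f i" if "n + rank i = n + rank i'"
    proof -
      obtain j' where "rank i' = Suc j'" "i' \<in> {pick n f j', f (pick n f j')}" using rank_Suc[OF i'] by blast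
      then show ?thesis using that j matchingD(2)[OF f pick_S[OF j(2)]] by auto
    qed
    assume h: "n + rank i < n + rank i'" "i' < n + rank i" "f i' < n + rank i"
    have fi': "f i' \<in> ?S" "f (f i') = i'" using matchingD[OF f i'] by auto
    have "i' \<notin> used n f (Suc j)" "f i' \<notin> used n f (Suc j)"
      using rank_le[of i' "Suc j"] rank_le[of "f i'" "Suc j"] rank_f[OF i'] h j by auto
    then have no: "i' \<notin> used n f j" "f i' \<notin> used n f j" "i' \<noteq> pick n f j" "f i' \<noteq> pick n f j"
      by (auto simp: used_Suc)
    have "pick n f j \<le> i'" "pick n f j \<le> f i'"
      using pick_props(3)[OF f j(2)] no h j i' fi' by auto
    moreover have "min i (f i) \<le> pick n f j" using j(3) matchingD(2)[OF f pick_S[OF j(2)]] by auto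
    ultimately show "min i (f i) < min i' (f i')" using no by (auto simp del: min_less_iff_conj simp: min_def)
  next
    fix v assume "v \<in> {n + 1..2 * n - 1}"
    then obtain j where j: "v = n + Suc j" "Suc j < n"
      by (intro that[of "v - n - 1"]) auto
    have "rank (pick n f j) = Suc j"
    proof (rule antisym)
      show "rank (pick n f j) \<le> Suc j" using rank_le[of "pick n f j"] by (simp add: used_Suc)
      show "Suc j \<le> rank (pick n f j)"
        using in_rank[OF pick_S[OF j(2)]] pick_props(1)[OF f j(2)] used_mono[of "rank (pick n f j)" j n f]
        by (meson DiffD2 not_less_eq_eq subsetD)
    qed
    then show "\<exists>i\<in>?S. n + rank i = v" using pick_S[OF j(2)] j by (intro bexI[of _ "pick n f j"]) simp_all
  qed (use f n in auto)
  then show ?thesis by blast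
qed

section \<open>The matching of a labelled tree\<close>

locale labelled_tree = greedy_labelling t "2 * n - 2" lab for t n lab +
  assumes tree: "labelled_binary_tree n t" and two_le: "2 \<le> n"
begin

lemma length_leaves: "length (leaves t) = n"
  using tree by (simp add: labelled_binary_tree_def)

text \<open>\<open>lab\<close> is an arbitrary complete greedy labelling, so that a rebuilt tree can
  supply its own; uniqueness identifies it with the result of the loop.\<close>

lemma psi_labels_eq: "psi_labels t = lab"
  using greedy_labelling_unique greedy_labelling_psi_labels[OF tree two_le] greedy_labelling_axioms by blast

text \<open>There are exactly as many labels as non-root vertices, and labels are injective.\<close>

lemma total:
  assumes "q \<in> positions t" and "q \<noteq> []"
  shows "\<exists>v. lab q = Some v"
proof -
  have "{q. lab q \<noteq> None} = positions t - {[]}"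
  proof (rule card_subset_eq)
    show "card {q. lab q \<noteq> None} = card (positions t - {[]})"
      using m_eq_card card_nonroot[of t] length_leaves by simp
  qed (use dom in auto)
  then show ?thesis using assms by auto
qed

lemma sibling_position: "q @ [b] \<in> positions t \<Longrightarrow> q @ [c] \<in> positions t"
  by (auto simp: positions_def subtree_at_snoc)

lemma sibling_lab:
  assumes "lab (q @ [b]) = Some i"
  shows "\<exists>j. lab (q @ [c]) = Some j"
  using dom[OF assms] sibling_position total by blast

lemma psi_sibling:
  assumes "lab (q @ [b]) = Some i" and "lab (q @ [\<not> b]) = Some j"
  shows "psi t i = j"
proof -
  have "(THE j. \<exists>q b. lab (q @ [b]) = Some i \<and> lab (q @ [\<not> b]) = Some j) = j"
  proof (rule the_equality)
    fix j' assume "\<exists>q b. lab (q @ [b]) = Some i \<and> lab (q @ [\<not> b]) = Some j'"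
    then obtain q' b' where q': "lab (q' @ [b']) = Some i" "lab (q' @ [\<not> b']) = Some j'" by blast
    then have "q' = q" "b' = b" using inj[OF assms(1) q'(1)] by auto
    then show "j' = j" using q' assms by simp
  qed (use assms in blast)
  then show ?thesis using lab_range[OF assms(1)] by (simp add: psi_def Let_def psi_labels_eq length_leaves)
qed

lemma label_position:
  assumes "i \<in> {1..2 * n - 2}"
  shows "\<exists>q b. lab (q @ [b]) = Some i \<and> lab (q @ [\<not> b]) = Some (psi t i)"
proof -
  obtain q' where q': "lab q' = Some i" using lab_surj[OF assms] by blast
  then obtain q b where "q' = q @ [b]" using dom by (metis rev_exhaust)
  then show ?thesis using sibling_lab q' psi_sibling by blast
qed

lemma matching_psi: "matching (2 * n - 2) (psi t)"
  unfolding matching_def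
proof (intro conjI ballI allI impI)
  fix i assume "i \<in> {1..2 * n - 2}"
  then obtain q b where q: "lab (q @ [b]) = Some i" "lab (q @ [\<not> b]) = Some (psi t i)"
    using label_position by blast
  show "psi t i \<in> {1..2 * n - 2}" using lab_range[OF q(2)] .
  show "psi t (psi t i) = i" using psi_sibling[of q "\<not> b" "psi t i" i] q by simp
  show "psi t i \<noteq> i" using inj[OF q(1), of "q @ [\<not> b]"] q(2) by auto
next
  fix i assume "i \<notin> {1..2 * n - 2}"
  then show "psi t i = i" by (auto simp: psi_def Let_def length_leaves)
qed

lemma leaf_label_iff:
  assumes "lab q = Some v"
  shows "v \<le> n \<longleftrightarrow> subtree_at t q = Some (Leaf v)"
proof
  assume "v \<le> n"
  then have "\<not> internal_nonroot t q" using internal assms length_leaves by fastforce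
  then obtain a where "subtree_at t q = Some (Leaf a)" using internal_nonroot_or_leaf dom[OF assms] by blast
  then show "subtree_at t q = Some (Leaf v)" using leaf assms by fastforce
next
  assume "subtree_at t q = Some (Leaf v)"
  then have "v \<in> set (leaves t)" using set_leaves by blast
  then show "v \<le> n" using tree by (simp add: labelled_binary_tree_def)
qed

text \<open>Labels up to \<open>n\<close> sit on leaves and larger ones on internal vertices, so a
  crossing pair is a leaf with an internal sibling, counted at the leaf.\<close>

lemma crossing_pairs_psi: "crossing_pairs n (psi t) = single_leaves t"
proof -
  let ?C = "{i \<in> {1..n}. psi t i \<in> {n + 1..2 * n - 2}}"
  have "bij_betw (\<lambda>q. the (lab q)) (single_positions t) ?C"
    unfolding bij_betw_def
  proof
    have "lab q \<noteq> None" if "q \<in> single_positions t" for q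
      using that leaf by (auto simp: single_positions_def)
    then show "inj_on (\<lambda>q. the (lab q)) (single_positions t)"
      using inj by (intro inj_onI) (metis option.collapse)
    show "(\<lambda>q. the (lab q)) ` single_positions t = ?C"
    proof
      show "(\<lambda>q. the (lab q)) ` single_positions t \<subseteq> ?C"
      proof
        fix i assume "i \<in> (\<lambda>q. the (lab q)) ` single_positions t"
        then obtain q b a l r where q: "subtree_at t (q @ [b]) = Some (Leaf a)"
          "subtree_at t (q @ [\<not> b]) = Some (Node l r)" "i = the (lab (q @ [b]))"
          unfolding single_positions_def by blast
        have i: "lab (q @ [b]) = Some i" using leaf[OF q(1)] q(3) by simp
        obtain j where j: "lab (q @ [\<not> b]) = Some j" using sibling_lab[OF i] by blast
        have "\<not> j \<le> n" using leaf_label_iff[OF j] q(2) by simp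
        moreover have "i \<le> n" using leaf_label_iff[OF i] q(1) leaf[OF q(1)] i by simp
        ultimately show "i \<in> ?C" using lab_range[OF i] lab_range[OF j] psi_sibling[OF i j] by simp
      qed
      show "?C \<subseteq> (\<lambda>q. the (lab q)) ` single_positions t"
      proof
        fix i assume i: "i \<in> ?C"
        then have "i \<in> {1..2 * n - 2}" using two_le by auto
        then obtain q b where q: "lab (q @ [b]) = Some i" "lab (q @ [\<not> b]) = Some (psi t i)"
          using label_position by blast
        have "subtree_at t (q @ [b]) = Some (Leaf i)" using leaf_label_iff[OF q(1)] i by simp
        moreover have "subtree_at t (q @ [\<not> b]) \<noteq> Some (Leaf a)" for a
          using leaf_label_iff[OF q(2)] i leaf[of "q @ [\<not> b]" a] q(2) by auto
        then obtain l r where "subtree_at t (q @ [\<not> b]) = Some (Node l r)"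
          using internal_nonroot_or_leaf[of "q @ [\<not> b]" t] dom[OF q(2)] by (auto simp: internal_nonroot_def)
        ultimately have "q @ [b] \<in> single_positions t" unfolding single_positions_def by blast
        then show "i \<in> (\<lambda>q. the (lab q)) ` single_positions t" using q(1) by (intro image_eqI[of _ _ "q @ [b]"]) auto
      qed
    qed
  qed
  from bij_betw_same_card[OF this] show ?thesis
    by (simp add: crossing_pairs_def card_single_positions)
qed

definition full :: "bool list \<Rightarrow> nat option" where
  "full = lab([] \<mapsto> 2 * n - 1)"

definition parent :: "nat \<Rightarrow> nat" where
  "parent i = (THE v. \<exists>q b. lab (q @ [b]) = Some i \<and> full q = Some v)"

lemma parent_eq:
  assumes "lab (q @ [b]) = Some i" and "full q = Some v"
  shows "parent i = v"
  unfolding parent_def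
proof (rule the_equality)
  fix v' assume "\<exists>q b. lab (q @ [b]) = Some i \<and> full q = Some v'"
  then obtain q' b' where q': "lab (q' @ [b']) = Some i" "full q' = Some v'" by blast
  then have "q' = q" using inj[OF assms(1) q'(1)] by auto
  then show "v' = v" using q' assms by simp
qed (use assms in blast)

lemma full_inj: "full q = Some v \<Longrightarrow> full q' = Some v \<Longrightarrow> q = q'"
  using inj lab_range[of q v] lab_range[of q' v] two_le by (auto simp: full_def split: if_splits)

lemma full_child: "lab (q @ [b]) = Some i \<Longrightarrow> full (q @ [b]) = Some i"
  by (simp add: full_def)

lemma root_Node: "\<exists>l r. t = Node l r"
  using length_leaves two_le by (cases t) auto

lemma full_internal:
  assumes "full q = Some v"
  shows "n < v \<longleftrightarrow> (\<exists>l r. subtree_at t q = Some (Node l r))"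
proof (cases "q = []")
  case True
  then show ?thesis using assms root_Node two_le by (auto simp: full_def)
next
  case False
  then have q: "lab q = Some v" using assms by (simp add: full_def)
  obtain s where "subtree_at t q = Some s" using dom[OF q] by (auto simp: positions_def)
  then show ?thesis using leaf_label_iff[OF q] leaf[of q] q by (cases s) auto
qed

lemma full_children:
  assumes "full q = Some v" and "n < v"
  shows "\<exists>i. lab (q @ [b]) = Some i \<and> i < v"
proof -
  obtain l r where lr: "subtree_at t q = Some (Node l r)" using full_internal assms by blast
  show ?thesis
  proof (cases "q = []")
    case True
    have "q @ [b] \<in> positions t" using lr by (simp add: positions_def subtree_at_append)
    then obtain i where i: "lab (q @ [b]) = Some i" using total by blast
    then show ?thesis using lab_range[OF i] True assms two_le by (auto simp: full_def)
  next
    case False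
    then have "internal_nonroot t q" "lab q = Some v" using lr assms by (auto simp: internal_nonroot_def full_def)
    from children[OF this] show ?thesis by (cases b) auto
  qed
qed

lemma full_parent:
  assumes "lab (q @ [b]) = Some i"
  shows "full q = Some (parent i) \<and> n < parent i \<and> parent i \<le> 2 * n - 1"
proof -
  obtain l r where lr: "subtree_at t q = Some (Node l r)"
    using dom[OF assms] by (auto simp: positions_def subtree_at_snoc)
  then have "\<exists>v. full q = Some v"
    using total[of q] by (cases "q = []") (auto simp: full_def positions_def)
  then obtain v where v: "full q = Some v" ..
  have "n < v" using full_internal[OF v] lr by blast
  moreover have "v \<le> 2 * n - 1" using v lab_range[of q v] by (auto simp: full_def split: if_splits)
  ultimately show ?thesis using parent_eq[OF assms v] v by simp
qed

text \<open>Transfers the greedy condition from vertices to sibling pairs. The new case is a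
  comparison with the pair below the root, about which the condition on non-root vertices says
  nothing.\<close>

lemma greedy_parents_parent: "greedy_parents n (psi t) parent"
proof
  show "2 \<le> n" by (rule two_le)
  show "matching (2 * n - 2) (psi t)" by (rule matching_psi)
  show "\<exists>i\<in>{1..2 * n - 2}. parent i = v" if v: "v \<in> {n + 1..2 * n - 1}" for v
  proof -
    have "\<exists>q. full q = Some v"
    proof (cases "v = 2 * n - 1")
      case False
      then have "v \<in> {1..2 * n - 2}" using v by auto
      then obtain q where "lab q = Some v" using lab_surj by blast
      then show ?thesis using dom[of q v] by (intro exI[of _ q]) (simp add: full_def)
    qed (auto simp: full_def)
    then obtain q where q: "full q = Some v" ..
    then obtain i where i: "lab (q @ [False]) = Some i" using full_children v by fastforce
    then show ?thesis using lab_range[OF i] parent_eq[OF i q] by blast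
  qed
  fix i assume i: "i \<in> {1..2 * n - 2}"
  obtain q b where q: "lab (q @ [b]) = Some i" "lab (q @ [\<not> b]) = Some (psi t i)"
    using label_position[OF i] by blast
  note p = full_parent[OF q(1)]
  show "parent i \<in> {n + 1..2 * n - 1}" using p by auto
  show "parent (psi t i) = parent i" using parent_eq[OF q(2)] p by blast
  show "i < parent i" using full_children[of q "parent i" b] p q(1) by auto
  fix j assume j: "j \<in> {1..2 * n - 2}"
  obtain q' b' where q': "lab (q' @ [b']) = Some j" "lab (q' @ [\<not> b']) = Some (psi t j)"
    using label_position[OF j] by blast
  note p' = full_parent[OF q'(1)]
  show "j = i \<or> j = psi t i" if "parent i = parent j"
  proof -
    have "q' = q" using full_inj p p' that by metis
    then show ?thesis using q q' by (cases "b' = b") auto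
  qed
  show "min i (psi t i) < min j (psi t j)"
    if h: "parent i < parent j" "j < parent i" "psi t j < parent i"
  proof -
    \<comment> \<open>\<open>greedy\<close> lists children by direction, whereas a pair
      \<open>i\<close>, \<open>psi t i\<close> may come in either order; the minimum does not see
      this.\<close>
    have kids: "\<exists>a b. lab (u @ [False]) = Some a \<and> lab (u @ [True]) = Some b \<and> min a b = min x y"
      if "lab (u @ [c]) = Some x" "lab (u @ [\<not> c]) = Some y" for u c x y
      using that by (cases c) (auto simp: min.commute)
    obtain a b where ab: "lab (q @ [False]) = Some a" "lab (q @ [True]) = Some b" "min a b = min i (psi t i)"
      using kids[OF q] by blast
    obtain x y where ab': "lab (q' @ [False]) = Some x" "lab (q' @ [True]) = Some y" "min x y = min j (psi t j)"
      using kids[OF q'] by blast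
    have "x \<in> {j, psi t j}" "y \<in> {j, psi t j}" using ab' q' by (cases b'; auto)+
    then have less: "x < parent i" "y < parent i" using h by auto
    have "q \<noteq> []" using h p p' by (auto simp: full_def)
    then have lq: "lab q = Some (parent i)" "internal_nonroot t q"
      using p full_internal[of q "parent i"] by (auto simp: full_def internal_nonroot_def)
    show ?thesis
    proof (cases "q' = []")
      case False
      then have "lab q' = Some (parent j)" "internal_nonroot t q'"
        using p' full_internal[of q' "parent j"] by (auto simp: full_def internal_nonroot_def)
      then show ?thesis using greedy[OF lq(2,1) ab(1,2) _ _ ab'(1,2) less] ab ab' h(1) by auto
    next
      case True
      \<comment> \<open>The largest label \<open>2n-2\<close> has a larger parent label, which can
        only be that of the root. So one child of the root is not below \<open>parent i\<close>,
        against the assumptions.\<close>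
      have "2 * n - 2 \<in> {1..2 * n - 2}" using two_le by auto
      then obtain u c where u: "lab (u @ [c]) = Some (2 * n - 2)" using label_position by blast
      note pu = full_parent[OF u]
      have "2 * n - 2 < parent (2 * n - 2)" using full_children[of u _ c] pu u by auto
      then have "full u = full []" using pu by (auto simp: full_def)
      then have "u = []" using full_inj pu by metis
      then have "2 * n - 2 \<in> {x, y}" using u ab'(1,2) True by (cases c) auto
      moreover have "parent i \<le> 2 * n - 2" using lab_range[OF lq(1)] by simp
      ultimately show ?thesis using less by auto
    qed
  qed
qed

end

section \<open>Injectivity of \<open>psi\<close> and the tree rebuilt from a matching\<close>

lemma canonical_subtree: "canonical t \<Longrightarrow> subtree_at t q = Some s \<Longrightarrow> canonical s"
  by (induction t q rule: subtree_at.induct) (auto split: if_splits)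

lemma labelled_tree_psi_labels:
  assumes "labelled_binary_tree n t" and "2 \<le> n"
  shows "labelled_tree t n (psi_labels t)"
  using assms greedy_labelling_psi_labels by (simp add: labelled_tree_def labelled_tree_axioms_def)

text \<open>Equal matchings have equal parent labels. By induction on the label, vertices with the
  same \<open>full\<close> label carry the same subtree; the root label \<open>2n-1\<close> then
  gives the whole tree.\<close>

lemma psi_inj:
  assumes "labelled_binary_tree n t" and "labelled_binary_tree n t'" and "2 \<le> n" and eq: "psi t = psi t'"
  shows "t = t'"
proof -
  interpret a: labelled_tree t n "psi_labels t" using labelled_tree_psi_labels assms by blast
  interpret b: labelled_tree t' n "psi_labels t'" using labelled_tree_psi_labels assms by blast
  have par: "a.parent i = b.parent i" if "i \<in> {1..2 * n - 2}" for i
    using greedy_parents_unique[OF a.greedy_parents_parent] b.greedy_parents_parent eq that by metis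
  have sub: "subtree_at t q = subtree_at t' q'" if "a.full q = Some v" "b.full q' = Some v" for q q' v
    using that
  proof (induction v arbitrary: q q' rule: less_induct)
    case (less v)
    show ?case
    proof (cases "n < v")
      case False
      then have "q \<noteq> []" "q' \<noteq> []" using less.prems assms(3) by (auto simp: a.full_def b.full_def)
      then have "psi_labels t q = Some v" "psi_labels t' q' = Some v"
        using less.prems by (auto simp: a.full_def b.full_def)
      then show ?thesis using False a.leaf_label_iff[of q v] b.leaf_label_iff[of q' v] by simp
    next
      case True
      obtain l r where lr: "subtree_at t q = Some (Node l r)" using a.full_internal less.prems(1) True by blast
      obtain l' r' where lr': "subtree_at t' q' = Some (Node l' r')" using b.full_internal less.prems(2) True by blast
      obtain i j where ij: "psi_labels t (q @ [False]) = Some i" "i < v" "psi_labels t (q @ [True]) = Some j" "j < v"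
        using a.full_children[OF less.prems(1) True] by meson
      obtain i' j' where ij': "psi_labels t' (q' @ [False]) = Some i'" "i' < v" "psi_labels t' (q' @ [True]) = Some j'" "j' < v"
        using b.full_children[OF less.prems(2) True] by meson
      have psi_i: "psi t i = j" using a.psi_sibling[of q False] ij by simp
      have psi_i': "psi t i' = j'" using b.psi_sibling[of q' False] ij' eq by simp
      have rng: "i \<in> {1..2 * n - 2}" "i' \<in> {1..2 * n - 2}" using a.lab_range[OF ij(1)] b.lab_range[OF ij'(1)] by auto
      have "a.parent i = v" "a.parent i' = v"
        using a.parent_eq[OF ij(1) less.prems(1)] b.parent_eq[OF ij'(1) less.prems(2)] par[OF rng(2)] by auto
      then have "i' = i \<or> i' = j"
        using greedy_parents.par_eq[OF a.greedy_parents_parent rng] psi_i by simp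
      then show ?thesis
      proof
        assume i: "i' = i"
        then have j: "j' = j" using psi_i psi_i' by simp
        have "subtree_at t (q @ [False]) = subtree_at t' (q' @ [False])"
          using less.IH[OF ij(2)] a.full_child[OF ij(1)] b.full_child[OF ij'(1)] i by simp
        moreover have "subtree_at t (q @ [True]) = subtree_at t' (q' @ [True])"
          using less.IH[OF ij(4)] a.full_child[OF ij(3)] b.full_child[OF ij'(3)] j by simp
        ultimately show ?thesis using lr lr' by (simp add: subtree_at_append)
      next
        assume i: "i' = j"
        then have j: "j' = i" using psi_i psi_i' matchingD(2)[OF a.matching_psi rng(1)] by simp
        have "subtree_at t (q @ [False]) = subtree_at t' (q' @ [True])"
          using less.IH[OF ij(2)] a.full_child[OF ij(1)] b.full_child[OF ij'(3)] j by simp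
        then have "l = r'" using lr lr' by (simp add: subtree_at_append)
        have "subtree_at t (q @ [True]) = subtree_at t' (q' @ [False])"
          using less.IH[OF ij(4)] a.full_child[OF ij(3)] b.full_child[OF ij'(1)] i by simp
        then have "r = l'" using lr lr' by (simp add: subtree_at_append)
        \<comment> \<open>Were the children exchanged, both orders would be canonical, but the
          comparison of minima is strict.\<close>
        have "canonical (Node l r)" "canonical (Node r l)"
          using canonical_subtree[OF _ lr] canonical_subtree[OF _ lr'] \<open>l = r'\<close> \<open>r = l'\<close> assms(1,2)
          by (auto simp: labelled_binary_tree_def)
        then show ?thesis by simp
      qed
    qed
  qed
  have "subtree_at t [] = subtree_at t' []"
    by (rule sub[of _ "2 * n - 1"]) (auto simp: a.full_def b.full_def)
  then show ?thesis by simp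
qed

text \<open>The guards give termination for arbitrary \<open>c\<close> and \<open>d\<close>; for the
  child functions of a matching they hold at every label in \<open>{n+1..2n-1}\<close>. Using
  \<open>node\<close> restores the canonical order.\<close>

function build :: "nat \<Rightarrow> (nat \<Rightarrow> nat) \<Rightarrow> (nat \<Rightarrow> nat) \<Rightarrow> nat \<Rightarrow> ltree" where
  "build n c d v = (if n < v \<and> c v < v \<and> d v < v then node (build n c d (c v)) (build n c d (d v)) else Leaf v)"
  by pat_completeness auto
termination by (relation "measure (\<lambda>(n, c, d, v). v)") auto

declare build.simps [simp del]

context greedy_parents
begin

text \<open>Two labels share the parent \<open>v\<close>; either may be chosen, because
  \<open>child\<close> later sorts them by their subtrees.\<close>

definition first_child :: "nat \<Rightarrow> nat" where
  "first_child v = (SOME i. i \<in> {1..2 * n - 2} \<and> par i = v)"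

definition tree_of :: "nat \<Rightarrow> ltree" where
  "tree_of = build n first_child (\<lambda>v. f (first_child v))"

text \<open>Mirrors the decision of \<open>node\<close> inside \<open>build\<close>, so
  \<open>child False v\<close> labels the left subtree of \<open>tree_of v\<close> and
  \<open>child True v\<close> the right one.\<close>

definition child :: "bool \<Rightarrow> nat \<Rightarrow> nat" where
  "child b v =
    (if (Min (set (leaves (tree_of (first_child v)))) < Min (set (leaves (tree_of (f (first_child v)))))) \<noteq> b
     then first_child v else f (first_child v))"

lemma first_child:
  assumes "v \<in> {n + 1..2 * n - 1}"
  shows "first_child v \<in> {1..2 * n - 2}" "par (first_child v) = v"
  using someI_ex[of "\<lambda>i. i \<in> {1..2 * n - 2} \<and> par i = v"] par_surj[OF assms] unfolding first_child_def by blast+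

lemma child_props:
  assumes "v \<in> {n + 1..2 * n - 1}"
  shows "child b v \<in> {1..2 * n - 2}" "par (child b v) = v" "child b v < v" "f (child b v) = child (\<not> b) v"
    "child True v \<noteq> child False v"
proof -
  note c = first_child[OF assms]
  note m = matchingD[OF matching c(1)]
  show S: "child b v \<in> {1..2 * n - 2}" using c m by (simp add: child_def)
  show p: "par (child b v) = v" using c m par_f[OF c(1)] by (simp add: child_def)
  show "child b v < v" using par_less[OF S] p by simp
  show "f (child b v) = child (\<not> b) v" using m by (simp add: child_def)
  show "child True v \<noteq> child False v" using m by (auto simp: child_def)
qed

lemma child_ex:
  assumes "i \<in> {1..2 * n - 2}"
  shows "\<exists>b. i = child b (par i)"
proof -
  note c = child_props[OF par_range[OF assms]]
  have "i = child True (par i) \<or> i = f (child True (par i))"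
    using par_eq[OF c(1) assms] c(2) by simp
  then show ?thesis using c(4)[of True] by auto
qed

lemma tree_of_leaf: "v \<le> n \<Longrightarrow> tree_of v = Leaf v"
  by (simp add: tree_of_def build.simps)

lemma tree_of_Node:
  assumes "v \<in> {n + 1..2 * n - 1}"
  shows "tree_of v = Node (tree_of (child False v)) (tree_of (child True v))"
proof -
  note c = first_child[OF assms]
  have "first_child v < v" "f (first_child v) < v"
    using par_less c par_f matchingD(1)[OF matching c(1)] by metis+
  then have "tree_of v = node (tree_of (first_child v)) (tree_of (f (first_child v)))"
    using assms by (subst tree_of_def, subst build.simps) (simp add: tree_of_def)
  then show ?thesis by (auto simp: node_def child_def)
qed

text \<open>Distinct leaves make the minima of the two subtrees different, so the order chosen by
  \<open>node\<close> is strict. The hypothesis passes to subtrees and need only be proved at the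
  root.\<close>

lemma canonical_tree_of:
  assumes "v \<in> {1..2 * n - 1}" and "distinct (leaves (tree_of v))"
  shows "canonical (tree_of v)"
  using assms
proof (induction v rule: less_induct)
  case (less v)
  show ?case
  proof (cases "v \<le> n")
    case False
    then have v: "v \<in> {n + 1..2 * n - 1}" using less.prems by simp
    note c = child_props[OF v]
    have "child b v \<in> {1..2 * n - 1}" for b using c(1)[of b] by auto
    then have "canonical (tree_of (child b v))" for b
      using less.IH[OF c(3)[of b]] less.prems(2) unfolding tree_of_Node[OF v] by (cases b) auto
    moreover have "set (leaves (tree_of (child False v))) \<inter> set (leaves (tree_of (child True v))) = {}"
      using less.prems(2) unfolding tree_of_Node[OF v] by simp
    then have "Min (set (leaves (tree_of (child False v)))) \<noteq> Min (set (leaves (tree_of (child True v))))"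
      by (rule Min_leaves_neq)
    then have "Min (set (leaves (tree_of (child False v)))) < Min (set (leaves (tree_of (child True v))))"
      by (auto simp: child_def split: if_splits)
    ultimately show ?thesis unfolding tree_of_Node[OF v] by simp
  qed (simp add: tree_of_leaf)
qed

text \<open>The counterpart of \<open>subtree_at\<close> on labels: it follows a position downwards
  through \<open>child\<close> and stops at leaf labels.\<close>

primrec label_at :: "nat \<Rightarrow> bool list \<Rightarrow> nat option" where
  "label_at v [] = Some v"
| "label_at v (b # q) = (if n < v then label_at (child b v) q else None)"

lemma label_at_snoc:
  "label_at v (q @ [b]) = Some i \<longleftrightarrow> (\<exists>w>n. label_at v q = Some w \<and> i = child b w)"
  by (induction q arbitrary: v) auto

lemma label_at_range:
  assumes "v \<in> {1..2 * n - 1}" and "label_at v q = Some w"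
  shows "w \<in> {1..2 * n - 1} \<and> (q \<noteq> [] \<longrightarrow> w < v)"
  using assms
proof (induction q arbitrary: v)
  case (Cons b q)
  then have v: "v \<in> {n + 1..2 * n - 1}" and q: "label_at (child b v) q = Some w" by (auto split: if_splits)
  note c = child_props[OF v]
  have "child b v \<in> {1..2 * n - 1}" using c(1)[of b] by auto
  from Cons.IH[OF this q] c(3)[of b] q show ?case by (cases q) auto
qed simp

lemma subtree_at_tree_of:
  assumes "v \<in> {1..2 * n - 1}"
  shows "subtree_at (tree_of v) q = map_option tree_of (label_at v q)"
  using assms
proof (induction q arbitrary: v)
  case (Cons b q)
  show ?case
  proof (cases "v \<le> n")
    case False
    then have v: "v \<in> {n + 1..2 * n - 1}" using Cons.prems by simp
    have "child b v \<in> {1..2 * n - 1}" using child_props(1)[OF v, of b] by auto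
    from Cons.IH[OF this] show ?thesis using False by (cases b) (auto simp: tree_of_Node[OF v])
  qed (simp add: tree_of_leaf)
qed simp

lemma label_at_root_snoc:
  assumes "label_at (2 * n - 1) (q @ [b]) = Some i"
  shows "i \<in> {1..2 * n - 2} \<and> par i \<in> {n + 1..2 * n - 1} \<and> label_at (2 * n - 1) q = Some (par i) \<and> i = child b (par i)"
proof -
  obtain w where w: "n < w" "label_at (2 * n - 1) q = Some w" "i = child b w"
    using assms label_at_snoc by blast
  have "w \<in> {n + 1..2 * n - 1}" using label_at_range[OF _ w(2)] w(1) two_le by auto
  with child_props[OF this] w show ?thesis by auto
qed

text \<open>A position is recovered from its end: a label fixes its parent label and the direction
  below it, and climbing stops at the root, the only vertex labelled \<open>2n-1\<close>.\<close>

lemma label_at_inj: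
  assumes "label_at (2 * n - 1) q = Some i" and "label_at (2 * n - 1) q' = Some i"
  shows "q = q'"
  using assms
proof (induction q arbitrary: q' i rule: rev_induct)
  case Nil
  then show ?case using label_at_range[of "2 * n - 1" q' i] two_le by auto
next
  case (snoc b q)
  note s = label_at_root_snoc[OF snoc.prems(1)]
  have "q' \<noteq> []" using s snoc.prems(2) two_le by auto
  then obtain p b' where q': "q' = p @ [b']" by (metis rev_exhaust)
  note s' = label_at_root_snoc[OF snoc.prems(2)[unfolded q']]
  have "q = p" using snoc.IH s s' by blast
  moreover have "child b (par i) = child b' (par i)" using s s' by simp
  then have "b = b'" using child_props(5)[of "par i"] s by (cases b; cases b') auto
  ultimately show ?case using q' by simp
qed

text \<open>Parents are larger, so repeatedly taking \<open>par\<close> climbs from any label to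
  \<open>2n-1\<close>.\<close>

lemma label_at_surj:
  assumes "i \<in> {1..2 * n - 1}"
  shows "\<exists>q. label_at (2 * n - 1) q = Some i"
  using assms
proof (induction "2 * n - 1 - i" arbitrary: i rule: less_induct)
  case less
  show ?case
  proof (cases "i = 2 * n - 1")
    case True
    then show ?thesis by (intro exI[of _ "[]"]) simp
  next
    case False
    then have i: "i \<in> {1..2 * n - 2}" using less.prems by auto
    note p = par_range[OF i] par_less[OF i]
    then have "2 * n - 1 - par i < 2 * n - 1 - i" "par i \<in> {1..2 * n - 1}" by auto
    then obtain q where q: "label_at (2 * n - 1) q = Some (par i)" using less.hyps by blast
    obtain b where b: "i = child b (par i)" using child_ex[OF i] by blast
    have "label_at (2 * n - 1) (q @ [b]) = Some i" using label_at_snoc q b p by fastforce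
    then show ?thesis ..
  qed
qed

definition root :: ltree where
  "root = tree_of (2 * n - 1)"

lemma subtree_at_root: "subtree_at root q = map_option tree_of (label_at (2 * n - 1) q)"
  using subtree_at_tree_of two_le by (simp add: root_def)

lemma root_label_range: "label_at (2 * n - 1) q = Some v \<Longrightarrow> v \<in> {1..2 * n - 1}"
  using label_at_range[of "2 * n - 1" q v] two_le by auto

lemma tree_of_eq_Leaf: "v \<in> {1..2 * n - 1} \<Longrightarrow> tree_of v = Leaf a \<longleftrightarrow> v = a \<and> v \<le> n"
  using tree_of_leaf[of v] tree_of_Node[of v] by (cases "v \<le> n") auto

lemma subtree_at_root_Leaf:
  "subtree_at root q = Some (Leaf a) \<longleftrightarrow> label_at (2 * n - 1) q = Some a \<and> a \<le> n"
  unfolding subtree_at_root using root_label_range[of q] tree_of_eq_Leaf by auto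

lemma labelled_binary_tree_root: "labelled_binary_tree n root"
proof -
  have d: "distinct (leaves root)" unfolding distinct_leaves_iff subtree_at_root_Leaf using label_at_inj by blast
  have s: "set (leaves root) = {1..n}"
  proof (intro set_eqI iffI)
    fix a assume "a \<in> set (leaves root)"
    then show "a \<in> {1..n}" unfolding set_leaves subtree_at_root_Leaf using root_label_range by auto
  next
    fix a assume a: "a \<in> {1..n}"
    then have "a \<in> {1..2 * n - 1}" by auto
    then show "a \<in> set (leaves root)" unfolding set_leaves subtree_at_root_Leaf using label_at_surj a by auto
  qed
  have "length (leaves root) = n" using distinct_card[OF d] s by simp
  moreover have "canonical root" using canonical_tree_of d two_le by (simp add: root_def)
  ultimately show ?thesis using d s by (simp add: labelled_binary_tree_def)
qed

definition root_labels :: "bool list \<Rightarrow> nat option" where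
  "root_labels q = (if q = [] then None else label_at (2 * n - 1) q)"

lemma root_labels_Some:
  "root_labels q = Some v \<longleftrightarrow> label_at (2 * n - 1) q = Some v \<and> v \<le> 2 * n - 2"
proof (cases "q = []")
  case True
  then show ?thesis using two_le by (auto simp: root_labels_def)
next
  case False
  have "v \<le> 2 * n - 2" if "label_at (2 * n - 1) q = Some v"
  proof -
    have "v < 2 * n - 1" using label_at_range[OF _ that] False two_le by simp
    then show ?thesis by simp
  qed
  with False show ?thesis by (auto simp: root_labels_def)
qed

lemma internal_nonroot_root:
  assumes "internal_nonroot root q"
  obtains v where "label_at (2 * n - 1) q = Some v" "n < v" "v \<le> 2 * n - 2"
proof -
  obtain v where v: "label_at (2 * n - 1) q = Some v" "\<And>a. tree_of v \<noteq> Leaf a" and q: "q \<noteq> []"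
    using assms unfolding internal_nonroot_def subtree_at_root by auto
  have "n < v" using v(2) tree_of_leaf[of v] by (cases "v \<le> n") auto
  moreover have "v < 2 * n - 1" using label_at_range[OF _ v(1)] q two_le by auto
  ultimately show ?thesis using that v(1) by auto
qed

lemma root_labels_child:
  assumes "label_at (2 * n - 1) q = Some v" and "n < v"
  shows "root_labels (q @ [b]) = Some (child b v)"
  using assms by (simp add: root_labels_def label_at_snoc)

text \<open>The loop is not run on the rebuilt tree. Its labels satisfy all clauses, with
  \<open>par_greedy\<close> supplying \<open>greedy\<close>, and hence agree with
  \<open>psi_labels root\<close>.\<close>

sublocale root: labelled_tree root n root_labels
proof
  show "labelled_binary_tree n root" by (rule labelled_binary_tree_root)
  have len: "length (leaves root) = n" using labelled_binary_tree_root by (simp add: labelled_binary_tree_def)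
  show "2 \<le> n" by (rule two_le)
  show "q \<noteq> [] \<and> q \<in> positions root" if "root_labels q = Some v" for q v
    using that by (auto simp: root_labels_def positions_def subtree_at_root split: if_splits)
  show "root_labels q = Some a" if "subtree_at root q = Some (Leaf a)" for q a
    using that two_le unfolding subtree_at_root_Leaf root_labels_Some by auto
  show "q = q'" if "root_labels q = Some v" "root_labels q' = Some v" for q q' v
    using that label_at_inj unfolding root_labels_Some by blast
  show "ran root_labels = {1..2 * n - 2}"
  proof (intro set_eqI iffI)
    fix v assume "v \<in> ran root_labels"
    then show "v \<in> {1..2 * n - 2}" using root_label_range by (auto simp: ran_def root_labels_Some)
  next
    fix v assume v: "v \<in> {1..2 * n - 2}"
    then have "v \<in> {1..2 * n - 1}" by auto
    then show "v \<in> ran root_labels" using label_at_surj v by (auto simp: ran_def root_labels_Some)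
  qed
  fix q v assume q: "internal_nonroot root q" "root_labels q = Some v"
  then have v: "label_at (2 * n - 1) q = Some v" "n < v" "v \<in> {n + 1..2 * n - 1}"
    using internal_nonroot_root[OF q(1)] unfolding root_labels_Some by force+
  note c = child_props[OF v(3)] root_labels_child[OF v(1,2)]
  show "length (leaves root) < v" using v len by simp
  show "\<exists>a b. root_labels (q @ [False]) = Some a \<and> root_labels (q @ [True]) = Some b \<and> a < v \<and> b < v"
    using c by blast
  fix a b q' a' b'
  assume h: "root_labels (q @ [False]) = Some a" "root_labels (q @ [True]) = Some b" "internal_nonroot root q'"
    "root_labels q' = None \<or> (\<exists>w>v. root_labels q' = Some w)"
    "root_labels (q' @ [False]) = Some a'" "root_labels (q' @ [True]) = Some b'" "a' < v" "b' < v"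
  obtain w where w: "label_at (2 * n - 1) q' = Some w" "n < w" "w \<le> 2 * n - 2"
    using internal_nonroot_root[OF h(3)] by blast
  then have "root_labels q' = Some w" by (simp add: root_labels_Some)
  then have vw: "v < w" using h(4) by auto
  have w': "w \<in> {n + 1..2 * n - 1}" using w by auto
  note c' = child_props[OF w'] root_labels_child[OF w(1,2)]
  have "a = child False v" "b = f a" "a' = child False w" "b' = f a'" using h c(4,6) c'(4,6) by auto
  then show "min a b < min a' b'" using par_greedy[of a a'] c(1,2) c'(1,2) vw h(7,8) by simp
qed

text \<open>Siblings in the rebuilt tree are labelled \<open>child b v\<close> and
  \<open>child (\<not> b) v\<close>, which \<open>f\<close> exchanges; outside
  \<open>{1..2n-2}\<close> both maps are the identity.\<close>

lemma psi_root: "psi root = f"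
proof
  fix i
  show "psi root i = f i"
  proof (cases "i \<in> {1..2 * n - 2}")
    case True
    then obtain q b where q: "root_labels (q @ [b]) = Some i" using root.label_position by blast
    then have "label_at (2 * n - 1) (q @ [b]) = Some i" by (simp add: root_labels_Some)
    note s = label_at_root_snoc[OF this]
    then have "root_labels (q @ [\<not> b]) = Some (child (\<not> b) (par i))" using root_labels_child by simp
    moreover have "child (\<not> b) (par i) = f i" using child_props(4)[of "par i" b] s by auto
    ultimately show ?thesis using root.psi_sibling[OF q] by simp
  next
    case False
    then show ?thesis using root.matching_psi matching by (simp add: matching_def)
  qed
qed

end

lemma psi_bij_betw:
  assumes "2 \<le> n"
  shows "bij_betw psi {t. labelled_binary_tree n t \<and> single_leaves t = k}
    {f. matching (2 * n - 2) f \<and> crossing_pairs n f = k}" (is "bij_betw psi ?A ?B")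
  unfolding bij_betw_def
proof
  show "inj_on psi ?A" using psi_inj assms by (auto intro: inj_onI)
  show "psi ` ?A = ?B"
  proof
    show "psi ` ?A \<subseteq> ?B"
    proof clarify
      fix t assume t: "labelled_binary_tree n t" "k = single_leaves t"
      interpret labelled_tree t n "psi_labels t" using labelled_tree_psi_labels t assms by blast
      show "matching (2 * n - 2) (psi t) \<and> crossing_pairs n (psi t) = single_leaves t"
        using matching_psi crossing_pairs_psi by blast
    qed
    show "?B \<subseteq> psi ` ?A"
    proof clarify
      fix f assume f: "matching (2 * n - 2) f" "k = crossing_pairs n f"
      obtain par where "greedy_parents n f par" using greedy_parents_exist[OF f(1) assms] by blast
      then interpret greedy_parents n f par .
      have "single_leaves root = crossing_pairs n f" using root.crossing_pairs_psi psi_root by simp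
      then show "f \<in> psi ` {t. labelled_binary_tree n t \<and> single_leaves t = crossing_pairs n f}"
        using labelled_binary_tree_root psi_root by (intro image_eqI[of _ _ root]) auto
    qed
  qed
qed

theorem theorem4:
  fixes n k :: nat
  assumes "n \<ge> 2"
  shows "bij_betw (\<lambda>(p, \<sigma>). phi p \<sigma>)
           {(p, \<sigma>). well_labelled_motzkin n p \<sigma> \<and> horizontal_steps p = k}
           {t. labelled_binary_tree n t \<and> single_leaves t = k}
       \<and> bij_betw psi
           {t. labelled_binary_tree n t \<and> single_leaves t = k}
           {f. matching (2*n-2) f \<and> crossing_pairs n f = k}"
  using phi_bij_betw[OF assms] psi_bij_betw[OF assms] by blast

end
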